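(* Let $\mu$ be an infinite cardinal, $\kappa=\mu^+$, and let $I$ be a $\kappa$-complete (proper, nonprincipal) ideal on $\kappa$. Then: (i) $I$ is $(\operatorname{cf}(\mu)+1,\kappa)$-regular, $I$ is $(1,\operatorname{cf}(\mu),\kappa)$-regular, and $I$ is $(2,\delta)$-regular for every $\delta<\kappa$; (ii) if $I$ is $(\operatorname{cf}(\mu),\kappa)$-regular, then $I$ is $(2,\kappa)$-regular; (iii) if $I$ is $(\alpha,\beta,\kappa)$-regular for some $\alpha,\beta<\kappa$ with $\mu^\beta=\mu$, then $I$ is $(2,\kappa)$-regular.
   Context: An ideal on a set $X$ is a family of subsets of $X$ closed under subsets and finite unions; it is $\kappa$-complete if closed under unions of fewer than $\kappa$ sets; all ideals are assumed proper ($X\notin I$) and nonprincipal ($\{x\}\in I$ for all $x\in X$). $I^+$ denotes the family of subsets of $X$ not in $I$. A sequence $\langle B_i\rangle$ is a refinement of $\langle A_i\rangle$ if $B_i\subseteq A_i$ for each $i$. For ordinals $\alpha,\beta$, an ideal $I$ is $(\alpha,\beta)$-regular if every sequence $\langle A_i:i<\beta\rangle\subseteq I^+$ has a refinement $\langle B_i:i<\beta\rangle\subseteq I^+$ such that $\bigcap_{i\in z}B_i=\emptyset$ for every $z\subseteq\beta$ of ordertype $\alpha$. For ordinals $\alpha,\beta,\gamma$, $I$ is $(\alpha,\beta,\gamma)$-regular if every sequence $\langle A_i:i<\gamma\rangle\subseteq I^+$ has a refinement $\langle B_i:i<\gamma\rangle\subseteq I^+$ such that $|\bigcap_{i\in x}B_i|\le\alpha$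 for every $x\subseteq\gamma$ of ordertype $\beta$. *)

theory Defs
  imports Main
begin

unbundle cardinal_syntax

text \<open>
  Ordinals are represented by well-orders, up to \<open>=o\<close>; infinite cardinals by relations satisfying
  \<^const>\<open>Cinfinite\<close>, i.e. infinite initial ordinals; \<open>natLeq_on n\<close> is the finite ordinal \<open>n\<close>.
\<close>

definition ordsuc :: "'a rel \<Rightarrow> 'a option rel" where
  "ordsuc r = {(Some a, Some b) | a b. (a, b) \<in> r} \<union> {(Some a, None) | a. a \<in> Field r} \<union> {(None, None)}"

text \<open>
  The cofinality is the least cardinality of a cofinal subset. The library predicate
  \<^const>\<open>cofinal\<close> asks for strict upper bounds, which makes no difference for the limit ordinals
  to which it is applied here.
\<close>

definition cf :: "'a rel \<Rightarrow> 'a rel" where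
  "cf r = (SOME c. \<exists>K. K \<subseteq> Field r \<and> cofinal K r \<and> c = |K| \<and>
      (\<forall>L. L \<subseteq> Field r \<and> cofinal L r \<longrightarrow> |K| \<le>o |L| ))"

definition ideal_on :: "'x set \<Rightarrow> 'x set set \<Rightarrow> bool" where
  "ideal_on X I \<longleftrightarrow> I \<subseteq> Pow X \<and> {} \<in> I
     \<and> (\<forall>A\<in>I. \<forall>B. B \<subseteq> A \<longrightarrow> B \<in> I)
     \<and> (\<forall>A\<in>I. \<forall>B\<in>I. A \<union> B \<in> I)"

definition proper_ideal :: "'x set \<Rightarrow> 'x set set \<Rightarrow> bool" where
  "proper_ideal X I \<longleftrightarrow> X \<notin> I"

definition nonprincipal_ideal :: "'x set \<Rightarrow> 'x set set \<Rightarrow> bool" where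
  "nonprincipal_ideal X I \<longleftrightarrow> (\<forall>x\<in>X. {x} \<in> I)"

definition complete_ideal :: "'k rel \<Rightarrow> 'x set set \<Rightarrow> bool" where
  "complete_ideal \<kappa> I \<longleftrightarrow> (\<forall>F. F \<subseteq> I \<and> |F| <o \<kappa> \<longrightarrow> \<Union>F \<in> I)"

definition positive_sets :: "'x set \<Rightarrow> 'x set set \<Rightarrow> 'x set set" where
  "positive_sets X I = Pow X - I"

definition refinement :: "'i set \<Rightarrow> ('i \<Rightarrow> 'x set) \<Rightarrow> ('i \<Rightarrow> 'x set) \<Rightarrow> bool" where
  "refinement J B A \<longleftrightarrow> (\<forall>i\<in>J. B i \<subseteq> A i)"

text \<open>
  \<open>Restr \<beta> z =o \<alpha>\<close> says that \<open>z\<close> has ordertype \<open>\<alpha>\<close>. The intersections are taken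
  inside \<open>X\<close>, which only matters for the empty index set.
\<close>

definition regular2 :: "'x set \<Rightarrow> 'x set set \<Rightarrow> 'b rel \<Rightarrow> 'i rel \<Rightarrow> bool" where
  "regular2 X I \<alpha> \<beta> \<longleftrightarrow>
     (\<forall>A. (\<forall>i\<in>Field \<beta>. A i \<in> positive_sets X I) \<longrightarrow>
        (\<exists>B. refinement (Field \<beta>) B A \<and> (\<forall>i\<in>Field \<beta>. B i \<in> positive_sets X I) \<and>
           (\<forall>z. z \<subseteq> Field \<beta> \<and> Restr \<beta> z =o \<alpha> \<longrightarrow> X \<inter> (\<Inter>i\<in>z. B i) = {})))"

definition regular3 :: "'x set \<Rightarrow> 'x set set \<Rightarrow> 'b rel \<Rightarrow> 'c rel \<Rightarrow> 'i rel \<Rightarrow> bool" where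
  "regular3 X I \<alpha> \<beta> \<gamma> \<longleftrightarrow>
     (\<forall>A. (\<forall>i\<in>Field \<gamma>. A i \<in> positive_sets X I) \<longrightarrow>
        (\<exists>B. refinement (Field \<gamma>) B A \<and> (\<forall>i\<in>Field \<gamma>. B i \<in> positive_sets X I) \<and>
           (\<forall>x. x \<subseteq> Field \<gamma> \<and> Restr \<gamma> x =o \<beta> \<longrightarrow> |X \<inter> (\<Inter>i\<in>x. B i)| \<le>o \<alpha>)))"

lemma cofinal_Field:
  assumes "Cinfinite r"
  shows "cofinal (Field r) r"
  unfolding cofinal_def
  using assms infinite_Card_order_limit[of r] by (auto simp: cinfinite_def Field_def)

lemma cf_spec:
  assumes "Cinfinite r"
  shows "\<exists>K. K \<subseteq> Field r \<and> cofinal K r \<and> cf r = |K| \<and>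
      (\<forall>L. L \<subseteq> Field r \<and> cofinal L r \<longrightarrow> |K| \<le>o |L| )"
proof -
  let ?R = "{ |K| | K. K \<subseteq> Field r \<and> cofinal K r}"
  have "?R \<noteq> {}" using cofinal_Field[OF assms] by blast
  moreover have "\<forall>c\<in>?R. Card_order c" using card_of_Card_order by blast
  ultimately obtain c where "c \<in> ?R" "\<forall>c'\<in>?R. c \<le>o c'"
    using exists_minim_Card_order[of ?R] by blast
  then have "\<exists>c K. K \<subseteq> Field r \<and> cofinal K r \<and> c = |K| \<and>
      (\<forall>L. L \<subseteq> Field r \<and> cofinal L r \<longrightarrow> |K| \<le>o |L| )" by blast
  then show ?thesis unfolding cf_def by (rule someI_ex)
qed

lemma Field_ordsuc: "Field (ordsuc r) = insert None (Some ` Field r)"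
  by (auto simp: ordsuc_def Field_def image_iff)

lemma Well_order_ordsuc:
  assumes "Well_order r"
  shows "Well_order (ordsuc r)"
proof -
  have rf: "Refl r" and tr: "trans r" and an: "antisym r" and to: "Total r" and wf: "wf (r - Id)"
    using assms unfolding order_on_defs by auto
  have "Refl (ordsuc r)"
    using rf unfolding refl_on_def Field_ordsuc by (auto simp: ordsuc_def Field_def)
  moreover have "trans (ordsuc r)"
    unfolding ordsuc_def by (rule transI) (auto simp: Field_def dest: transD[OF tr])
  moreover have "antisym (ordsuc r)"
    using an unfolding antisym_def by (auto simp: ordsuc_def)
  moreover have "Total (ordsuc r)"
    using to unfolding total_on_def Field_ordsuc by (auto simp: ordsuc_def)
  moreover have "wf (ordsuc r - Id)"
  proof (rule wfUNIVI)
    fix P x assume H: "\<forall>x. (\<forall>y. (y, x) \<in> ordsuc r - Id \<longrightarrow> P y) \<longrightarrow> P x"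
    have S: "P (Some a)" for a
    proof (induction a rule: wf_induct_rule[OF wf])
      case (1 a)
      have "P y" if "(y, Some a) \<in> ordsuc r - Id" for y
        using that 1 by (auto simp: ordsuc_def)
      then show ?case using H by blast
    qed
    have "P y" if "(y, None) \<in> ordsuc r - Id" for y
      using that S by (cases y) auto
    then have "P None" using H by blast
    with S show "P x" by (cases x) auto
  qed
  moreover have "ordsuc r \<subseteq> Field (ordsuc r) \<times> Field (ordsuc r)"
    by (auto simp: Field_def)
  ultimately show ?thesis unfolding order_on_defs by auto
qed

end

theory Submission
  imports Defs "HOL-Library.Disjoint_Sets"
begin

text \<open>
  Think of forcing with the positive sets. Below a dense set of conditions one of two things
  happens. Either \<open>\<kappa>\<close> acquires a cofinal sequence, represented in the generic ultrapower, whose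
  length is less than \<open>\<mu>\<close> and has a cofinality different from that of \<open>\<mu>\<close>; then \<open>\<kappa>\<^sup>+\<close> many
  eventually different functions from \<open>\<kappa>\<close> to \<open>\<kappa>\<close>, evaluated along the sequence, yield a matrix with
  \<open>\<mu>\<close> colours whose \<open>\<kappa>\<^sup>+\<close> many columns are pairwise different almost everywhere, and hence a
  disjoint refinement of any \<open>\<kappa>\<close> many such conditions. Or \<open>\<kappa>\<close> acquires a cofinal sequence of length
  \<open>cf \<mu>\<close>; then ranking \<open>i\<close> by the first term that can exceed \<open>i\<close> gives a refinement in which
  intersecting sets have strictly increasing ranks below \<open>cf \<mu>\<close>. Part (i) is read off from the
  ranks. If each point lies in fewer than \<open>cf \<mu>\<close> many sets, the indices of these sets replace the
  second kind of sequence, and the refinement can be made disjoint: this gives (ii), and (iii)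
  because \<open>\<mu>\<^sup>\<beta> = \<mu>\<close> implies \<open>|\<beta>| < cf \<mu>\<close> and leaves, for each \<open>i\<close>, only \<open>\<mu>\<close> many points that lie in
  \<open>\<beta>\<close> many sets with indices below \<open>i\<close>.
\<close>

section \<open>Well-orders and cardinals\<close>

lemma Well_order_not_le_iff:
  assumes "Well_order r" "a \<in> Field r" "b \<in> Field r"
  shows "(a, b) \<notin> r \<longleftrightarrow> b \<in> underS r a"
proof -
  interpret wo_rel r using assms(1) by unfold_locales
  show ?thesis
    using TOTALS ANTISYM assms(2,3) unfolding antisym_def Order_Relation.underS_def by blast
qed

lemma Well_order_underS_cases:
  assumes "Well_order r" "a \<in> Field r" "b \<in> Field r" "a \<noteq> b"
  shows "a \<in> underS r b \<or> b \<in> underS r a"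
  using assms Well_order_not_le_iff[OF assms(1-3)] unfolding underS_def by blast

lemma pairwise_Field:
  assumes "Well_order r" "\<And>a b. b \<in> underS r a \<Longrightarrow> P a b" "\<And>a b. P a b \<Longrightarrow> P b a"
  shows "pairwise P (Field r)"
  using Well_order_underS_cases[OF assms(1)] assms(2,3) unfolding pairwise_def by blast

lemma Well_order_refl: "Well_order r \<Longrightarrow> a \<in> Field r \<Longrightarrow> (a, a) \<in> r"
  unfolding order_on_defs refl_on_def by blast

lemma Well_order_trans: "Well_order r \<Longrightarrow> (a, b) \<in> r \<Longrightarrow> (b, c) \<in> r \<Longrightarrow> (a, c) \<in> r"
  unfolding order_on_defs trans_def by blast

lemma underS_le_trans:
  assumes "Well_order r" "a \<in> underS r b" "(b, c) \<in> r"
  shows "a \<in> underS r c"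
  using assms unfolding order_on_defs trans_def antisym_def underS_def by blast

lemma le_underS_trans:
  assumes "Well_order r" "(a, b) \<in> r" "b \<in> underS r c"
  shows "a \<in> underS r c"
  using assms unfolding order_on_defs trans_def antisym_def underS_def by blast

lemma underS_imp_le: "a \<in> underS r b \<Longrightarrow> (a, b) \<in> r"
  unfolding underS_def by blast

lemma underS_imp_Field: "a \<in> underS r b \<Longrightarrow> a \<in> Field r \<and> b \<in> Field r"
  unfolding underS_def Field_def by blast

lemma Well_order_least:
  assumes "Well_order r" "S \<subseteq> Field r" "S \<noteq> {}"
  obtains m where "m \<in> S" "\<And>s. s \<in> S \<Longrightarrow> (m, s) \<in> r"
  using wo_rel.minim_in[of r S] wo_rel.minim_least[of r S] assms unfolding wo_rel_def by blast

lemma card_of_subset_ordLeq: "A \<subseteq> B \<Longrightarrow> |B| \<le>o r \<Longrightarrow> |A| \<le>o r"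
  using card_of_mono1 ordLeq_transitive by blast

lemma card_of_subset_ordLess: "A \<subseteq> B \<Longrightarrow> |B| <o r \<Longrightarrow> |A| <o r"
  using card_of_mono1 ordLeq_ordLess_trans by blast

lemma card_of_image_ordLeq: "|A| \<le>o r \<Longrightarrow> |f ` A| \<le>o r"
  using card_of_image ordLeq_transitive by blast

lemma card_of_image_ordLess: "|A| <o r \<Longrightarrow> |f ` A| <o r"
  using card_of_image ordLeq_ordLess_trans by blast

lemma card_of_inj_ordLess:
  assumes "inj_on f A" "f ` A \<subseteq> B" "|B| <o r"
  shows "|A| <o r"
  using ordLeq_ordLess_trans[OF card_of_ordLeqI assms(3)] assms(1,2) by blast

lemma not_card_of_ordLeq_iff: "Card_order r \<Longrightarrow> \<not> |A| \<le>o r \<longleftrightarrow> r <o |A|"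
  by (rule not_ordLeq_iff_ordLess[OF card_order_on_well_order_on card_of_Well_order])

lemma not_card_of_ordLess_iff: "Card_order r \<Longrightarrow> \<not> |A| <o r \<longleftrightarrow> r \<le>o |A|"
  by (rule not_ordLess_iff_ordLeq[OF card_order_on_well_order_on card_of_Well_order])

lemma card_of_Field_ordLeq: "Card_order r \<Longrightarrow> |Field r| \<le>o r"
  by (rule ordIso_imp_ordLeq[OF card_of_Field_ordIso])

lemma not_card_of_Field_ordLess: "Card_order r \<Longrightarrow> \<not> |Field r| <o r"
  using card_of_Field_ordIso not_ordLess_ordIso by blast

lemma Field_not_subset_ordLess: "Card_order r \<Longrightarrow> |A| <o r \<Longrightarrow> \<not> Field r \<subseteq> A"
  using card_of_subset_ordLess not_card_of_Field_ordLess by blast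

lemma ordLeq_card_of_Field_iff:
  assumes "Card_order r"
  shows "|A| \<le>o |Field r| \<longleftrightarrow> |A| \<le>o r"
  using card_of_Field_ordIso[OF assms] ordIso_symmetric ordLeq_ordIso_trans by blast

lemma ordLess_card_of_Field_iff:
  assumes "Card_order r"
  shows "|A| <o |Field r| \<longleftrightarrow> |A| <o r"
  using card_of_Field_ordIso[OF assms] ordIso_symmetric ordLess_ordIso_trans by blast

lemma finite_ordLess_Cinfinite:
  assumes "finite A" "Cinfinite r"
  shows "|A| <o r"
  using assms finite_ordLess_infinite[OF card_of_Well_order, of r A] card_order_on_well_order_on
  by (auto simp: Field_card_of cinfinite_def)

lemma card_of_under:
  assumes "Cinfinite r" "a \<in> Field r"
  shows "|under r a| <o r"
proof -
  have Card_order_r: "Card_order r" and Well_order_r: "Well_order r"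
    using assms(1) card_order_on_well_order_on by blast+
  obtain b where b_in_Field: "b \<in> Field r" and a_less_b: "a \<in> underS r b"
    using infinite_Card_order_limit[OF Card_order_r _ assms(2)] assms(1)
    unfolding cinfinite_def underS_def by blast
  have "under r a \<subseteq> underS r b"
    using le_underS_trans[OF Well_order_r _ a_less_b] unfolding under_def by blast
  then show ?thesis using card_of_subset_ordLess card_of_underS[OF Card_order_r b_in_Field] by blast
qed

lemma Times_Cinfinite_bound_strict:
  assumes "|A| <o r" "|B| <o r" "Cinfinite r"
  shows "|A \<times> B| <o r"
proof (cases "finite A \<and> finite B")
  case True
  then show ?thesis using assms(3) by (simp add: finite_ordLess_Cinfinite)
next
  case False
  have "|A \<times> B| \<le>o |A <+> B|"
    using False card_of_Plus1[of A B] card_of_Plus2[of B A]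
    by (intro card_of_Times_ordLeq_infinite_Field) (auto simp: Field_card_of card_of_card_order_on)
  moreover have "|A <+> B| <o r"
    using assms by (intro card_of_Plus_ordLess_infinite_Field) (auto simp: cinfinite_def)
  ultimately show ?thesis by (rule ordLeq_ordLess_trans)
qed

lemma Well_order_choice_avoiding:
  fixes T :: "'a \<Rightarrow> 'b set"
  assumes Well_order_r: "Well_order r"
    and D_subset: "\<And>a. a \<in> Field r \<Longrightarrow> D a \<subseteq> underS r a"
    and less: "\<And>a. a \<in> Field r \<Longrightarrow> |D a| <o |T a|"
  shows "\<exists>f. \<forall>a\<in>Field r. f a \<in> T a \<and> f a \<notin> f ` D a"
proof -
  define P where "P f a y \<longleftrightarrow> (a \<in> Field r \<longrightarrow> y \<in> T a \<and> y \<notin> f ` D a)" for f a y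
  have "\<exists>f. \<forall>a. P f a (f a)"
  proof (rule dependent_wf_choice)
    show "wf (r - Id)" using Well_order_r unfolding well_order_on_def by blast
    show "P f a y = P g a y" if "\<And>b. (b, a) \<in> r - Id \<Longrightarrow> f b = g b" for f g a y
    proof -
      have "f ` D a = g ` D a" if "a \<in> Field r"
        using D_subset[OF that] \<open>\<And>b. (b, a) \<in> r - Id \<Longrightarrow> f b = g b\<close>
        by (intro image_cong) (auto simp: underS_def)
      then show ?thesis unfolding P_def by auto
    qed
    show "\<exists>y. P f a y" for f a
    proof (cases "a \<in> Field r")
      case True
      have "\<not> T a \<subseteq> f ` D a"
        using card_of_image_ordLess[OF less[OF True]] card_of_mono1 not_ordLess_ordLeq by blast
      then show ?thesis unfolding P_def by auto
    qed (auto simp: P_def)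
  qed
  then show ?thesis unfolding P_def by blast
qed

lemma injective_choice:
  assumes "\<And>i. i \<in> J \<Longrightarrow> |J| <o |T i|"
  shows "\<exists>g. (\<forall>i\<in>J. g i \<in> T i) \<and> inj_on g J"
proof -
  have Well_order_J: "Well_order |J|" by (rule card_of_Well_order)
  have underS_subset: "underS |J| i \<subseteq> J" for i
    using Order_Relation.underS_Field[of "|J|" i] by (simp add: Field_card_of)
  have "\<exists>g. \<forall>i\<in>Field |J|. g i \<in> T i \<and> g i \<notin> g ` underS |J| i"
    using assms underS_subset
    by (intro Well_order_choice_avoiding[OF Well_order_J])
      (auto simp: Field_card_of intro: ordLeq_ordLess_trans[OF card_of_mono1])
  then obtain g where g_avoids: "\<And>i. i \<in> J \<Longrightarrow> g i \<in> T i \<and> g i \<notin> g ` underS |J| i"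
    by (auto simp: Field_card_of)
  have "inj_on g J"
  proof (rule inj_onI, rule ccontr)
    fix i j assume "i \<in> J" "j \<in> J" "g i = g j" "i \<noteq> j"
    moreover from this have "i \<in> underS |J| j \<or> j \<in> underS |J| i"
      by (intro Well_order_underS_cases[OF Well_order_J]) (auto simp: Field_card_of)
    ultimately show False using g_avoids by (metis imageI)
  qed
  with g_avoids show ?thesis by blast
qed

text \<open>Choose the least element of each set in some fixed well-order.\<close>

lemma separating_choice:
  fixes S :: "'i \<Rightarrow> 'k set"
  assumes "\<And>i. i \<in> J \<Longrightarrow> S i \<noteq> {}"
  obtains \<pi> where "\<And>i. i \<in> J \<Longrightarrow> \<pi> i \<in> S i"
    "\<And>i j. i \<in> J \<Longrightarrow> j \<in> J \<Longrightarrow> \<pi> i \<noteq> \<pi> j \<Longrightarrow> \<pi> i \<notin> S j \<or> \<pi> j \<notin> S i"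
proof -
  let ?r = "|UNIV :: 'k set|"
  have "\<exists>k\<in>S i. \<forall>l\<in>S i. (k, l) \<in> ?r" if "i \<in> J" for i
    using Well_order_least[of ?r "S i"] assms[OF that]
    by (metis Field_card_of card_of_Well_order subset_UNIV)
  then obtain \<pi> where "\<And>i. i \<in> J \<Longrightarrow> \<pi> i \<in> S i"
    "\<And>i l. i \<in> J \<Longrightarrow> l \<in> S i \<Longrightarrow> (\<pi> i, l) \<in> ?r"
    by metis
  moreover have "antisym ?r"
    using card_of_Well_order[of "UNIV :: 'k set"] by (simp add: order_on_defs)
  ultimately show thesis using that unfolding antisym_def by metis
qed

subsection \<open>Subsets of a given ordertype\<close>

lemma Field_Restr_Well_order: "Well_order s \<Longrightarrow> z \<subseteq> Field s \<Longrightarrow> Field (Restr s z) = z"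
  using well_order_on_Restr well_order_on_Field by blast

lemma ordIso_Restr_imp_card_of:
  assumes "Well_order s" "z \<subseteq> Field s" "Restr s z =o r"
  shows "|z| =o |Field r|"
  using card_of_cong[OF assms(3)] Field_Restr_Well_order[OF assms(1,2)] by simp

lemma increasing_enumeration:
  assumes Card_order_r: "Card_order r" and Well_order_s: "Well_order s" and a_subset: "a \<subseteq> Field s"
    and card_a: "|a| <o r"
  shows "\<exists>\<tau>\<in>Field r. \<exists>f. bij_betw f (underS r \<tau>) a \<and>
    (\<forall>c\<in>underS r \<tau>. \<forall>d\<in>underS r \<tau>. (c, d) \<in> r \<longrightarrow> (f c, f d) \<in> s)"
proof -
  let ?s = "Restr s a"
  have Well_order_r: "Well_order r" by (rule card_order_on_well_order_on[OF Card_order_r])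
  have Well_order_a: "Well_order ?s" by (rule Well_order_Restr[OF Well_order_s])
  have Field_a: "Field ?s = a" by (rule Field_Restr_Well_order[OF Well_order_s a_subset])
  have "\<not> r \<le>o ?s"
    using card_of_mono2[of r ?s] card_a not_card_of_Field_ordLess[OF Card_order_r]
      ordLeq_ordLess_trans
    unfolding Field_a by blast
  then obtain \<tau> where \<tau>_in_Field: "\<tau> \<in> Field r" and \<tau>_iso: "?s =o Restr r (underS r \<tau>)"
    using ordLess_iff_ordIso_Restr[OF Well_order_r Well_order_a]
      not_ordLeq_iff_ordLess[OF Well_order_a Well_order_r] by blast
  obtain f where f_iso: "iso (Restr r (underS r \<tau>)) ?s f"
    using ordIso_symmetric[OF \<tau>_iso] unfolding ordIso_def by blast
  have Field_\<tau>: "Field (Restr r (underS r \<tau>)) = underS r \<tau>"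
    by (rule Field_Restr_Well_order[OF Well_order_r Order_Relation.underS_Field])
  have "compat (Restr r (underS r \<tau>)) ?s f" using f_iso embed_compat unfolding iso_def by blast
  then have "(f c, f d) \<in> s" if "c \<in> underS r \<tau>" "d \<in> underS r \<tau>" "(c, d) \<in> r" for c d
    using that unfolding compat_def by blast
  moreover have "bij_betw f (underS r \<tau>) a" using f_iso unfolding iso_def Field_\<tau> Field_a by blast
  ultimately show ?thesis using \<tau>_in_Field by blast
qed

lemma subset_of_ordertype:
  assumes Well_order_s: "Well_order s" and Z_subset: "Z \<subseteq> Field s" and r_le_Z: "r \<le>o |Z|"
  shows "\<exists>z\<subseteq>Z. Restr s z =o r"
proof -
  have "r \<le>o Restr s Z"
    using r_le_Z card_of_least[OF well_order_on_Restr[OF Well_order_s Z_subset]] ordLeq_transitive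
    by blast
  then obtain f where Well_order_r: "Well_order r" and Well_order_Restr_Z: "Well_order (Restr s Z)"
    and f_embed: "embed r (Restr s Z) f"
    unfolding ordLeq_def by auto
  let ?z = "f ` Field r"
  have z_subset_Z: "?z \<subseteq> Z"
    using embed_Field[OF f_embed] Field_Restr_Well_order[OF Well_order_s Z_subset] by simp
  have "iso r (Restr (Restr s Z) ?z) f"
    by (rule embed_implies_iso_Restr[OF Well_order_Restr_Z Well_order_r f_embed])
  then have "iso r (Restr s ?z) f" unfolding Restr_subset[OF z_subset_Z] .
  then have "r =o Restr s ?z"
    using Well_order_r Well_order_Restr[OF Well_order_s] unfolding ordIso_def by blast
  then show ?thesis using z_subset_Z ordIso_symmetric by blast
qed

lemma bounded_subset_of_ordertype:
  assumes Well_order_s: "Well_order s" and Z_subset: "Z \<subseteq> Field s" and r_less_Z: "r <o |Z|"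
  shows "\<exists>a\<in>Z. \<exists>z\<subseteq>Z \<inter> underS s a. Restr s z =o r"
proof -
  let ?s = "Restr s Z"
  have "r <o ?s"
    using r_less_Z card_of_least[OF well_order_on_Restr[OF Well_order_s Z_subset]]
      ordLess_ordLeq_trans by blast
  moreover from this have "Well_order r" unfolding ordLess_def by blast
  ultimately obtain a where a_in_Z: "a \<in> Z" and r_iso_a: "r =o Restr ?s (underS ?s a)"
    using ordLess_iff_ordIso_Restr[OF Well_order_Restr[OF Well_order_s], of r Z]
      Field_Restr_Well_order[OF Well_order_s Z_subset]
    by auto
  have underS_a_subset: "underS ?s a \<subseteq> Z \<inter> underS s a" unfolding underS_def by auto
  then have "Restr ?s (underS ?s a) = Restr s (underS ?s a)" by (intro Restr_subset) blast
  then have "Restr s (underS ?s a) =o r" using r_iso_a ordIso_symmetric by auto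
  then show ?thesis using a_in_Z underS_a_subset by blast
qed

lemma ordsuc_ordertype_greatest:
  assumes Well_order_s: "Well_order s" and z_subset: "z \<subseteq> Field s"
    and z_iso: "Restr s z =o ordsuc r"
  shows "\<exists>t\<in>z. |Field r| \<le>o |z \<inter> underS s t|"
proof -
  obtain g where g_iso: "iso (ordsuc r) (Restr s z) g"
    using ordIso_symmetric[OF z_iso] unfolding ordIso_def by blast
  have g_bij: "bij_betw g (insert None (Some ` Field r)) z"
    using g_iso unfolding iso_def Field_Restr_Well_order[OF Well_order_s z_subset] Field_ordsuc
    by blast
  have compat: "compat (ordsuc r) (Restr s z) g" using g_iso embed_compat unfolding iso_def by blast
  have "g (Some k) \<in> z \<inter> underS s (g None)" if "k \<in> Field r" for k
  proof -
    have "(Some k, None) \<in> ordsuc r" using that unfolding ordsuc_def by blast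
    then have "(g (Some k), g None) \<in> Restr s z" using compat unfolding compat_def by blast
    moreover have "g (Some k) \<noteq> g None" using g_bij that by (auto simp: bij_betw_def inj_on_def)
    ultimately show ?thesis unfolding underS_def by blast
  qed
  moreover have "inj_on (\<lambda>k. g (Some k)) (Field r)"
    using g_bij by (auto simp: bij_betw_def inj_on_def)
  moreover have "g None \<in> z" using g_bij by (auto simp: bij_betw_def)
  ultimately show ?thesis using card_of_ordLeqI by blast
qed

lemma card_of_subsets_ordLeq_cexp: "|{y. y \<subseteq> A \<and> |y| =o |Field \<beta>| }| \<le>o |A| ^c \<beta>"
  unfolding cexp_def Field_card_of
proof (rule surj_imp_ordLeq, rule subsetI)
  fix y assume y_subset: "y \<in> {y. y \<subseteq> A \<and> |y| =o |Field \<beta>| }"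
  then have "|Field \<beta>| =o |y|" using ordIso_symmetric by blast
  then obtain f where f_bij: "bij_betw f (Field \<beta>) y" unfolding card_of_ordIso[symmetric] by blast
  let ?f = "\<lambda>b. if b \<in> Field \<beta> then f b else undefined"
  have "?f \<in> Func (Field \<beta>) A" using f_bij y_subset unfolding Func_def bij_betw_def by auto
  moreover have "y = ?f ` Field \<beta>" using f_bij unfolding bij_betw_def by auto
  ultimately show "y \<in> (\<lambda>f. f ` Field \<beta>) ` Func (Field \<beta>) A" by blast
qed

subsection \<open>Cofinality\<close>

lemma not_cofinal_imp_bounded:
  assumes Cinfinite_r: "Cinfinite r" and L_subset: "L \<subseteq> Field r" and not_cofinal: "\<not> cofinal L r"
  shows "\<exists>b\<in>Field r. L \<subseteq> underS r b"
proof -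
  have Well_order_r: "Well_order r" using Cinfinite_r card_order_on_well_order_on by blast
  obtain b where b_in_Field: "b \<in> Field r" and b_not_less: "\<And>l. l \<in> L \<Longrightarrow> b \<notin> underS r l"
    using not_cofinal unfolding cofinal_def underS_def by blast
  obtain b' where b'_in_Field: "b' \<in> Field r" and b_less_b': "b \<in> underS r b'"
    using infinite_Card_order_limit[OF _ _ b_in_Field] Cinfinite_r
    unfolding cinfinite_def underS_def by blast
  have "l \<in> underS r b'" if "l \<in> L" for l
    using b_not_less[OF that] Well_order_not_le_iff[OF Well_order_r _ b_in_Field, of l] L_subset
      that
      le_underS_trans[OF Well_order_r _ b_less_b'] by blast
  then show ?thesis using b'_in_Field by blast
qed

lemma regularCard_bounded:
  assumes "Cinfinite r" "regularCard r" "L \<subseteq> Field r" "|L| <o r"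
  shows "\<exists>b\<in>Field r. L \<subseteq> underS r b"
  using assms not_cofinal_imp_bounded not_ordLess_ordIso unfolding regularCard_def by blast

context
  fixes r :: "'a rel"
  assumes r: "Cinfinite r"
begin

lemma Card_order_cf: "Card_order (cf r)"
  and Field_cf_subset: "Field (cf r) \<subseteq> Field r"
  and cofinal_Field_cf: "cofinal (Field (cf r)) r"
  and cf_ordLeq_cofinal: "L \<subseteq> Field r \<Longrightarrow> cofinal L r \<Longrightarrow> cf r \<le>o |L|"
  using cf_spec[OF r] card_of_Card_order by (auto simp: Field_card_of)

lemma Well_order_cf: "Well_order (cf r)"
  by (rule card_order_on_well_order_on[OF Card_order_cf])

lemma cf_ordLeq: "cf r \<le>o r"
  using cf_ordLeq_cofinal[OF subset_refl cofinal_Field[OF r]] r card_of_Field_ordLeq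
    ordLeq_transitive by blast

lemma ordLess_cf_bounded:
  assumes "L \<subseteq> Field r" "|L| <o cf r"
  shows "\<exists>b\<in>Field r. L \<subseteq> underS r b"
  using not_cofinal_imp_bounded[OF r assms(1)] cf_ordLeq_cofinal[OF assms(1)] assms(2)
    not_ordLess_ordLeq by blast

lemma Cinfinite_cf: "Cinfinite (cf r)"
proof -
  have "|\<Union>l\<in>L. underS r l| <o r" if "finite L" "L \<subseteq> Field r" for L
    using that
  proof (induction L)
    case empty
    then show ?case using r by (simp add: finite_ordLess_Cinfinite)
  next
    case (insert l L)
    then show ?case using r by (simp add: Un_Cinfinite_bound_strict card_of_underS)
  qed
  moreover have "Field r \<subseteq> (\<Union>l\<in>Field (cf r). underS r l)"
    using cofinal_Field_cf unfolding cofinal_def underS_def by blast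
  ultimately have "infinite (Field (cf r))"
    using Field_cf_subset Field_not_subset_ordLess r by blast
  then show ?thesis using Card_order_cf by (simp add: cinfinite_def)
qed

lemma cf_exceeds: "m \<in> Field r \<Longrightarrow> \<exists>k\<in>Field (cf r). m \<in> underS r k"
  using cofinal_Field_cf unfolding cofinal_def underS_def by blast

text \<open>Koenig's diagonal argument.\<close>

lemma cexp_ordLeq_imp_ordLess_cf:
  assumes Well_order_\<beta>: "Well_order \<beta>" and exp_le: "r ^c \<beta> \<le>o r"
  shows "\<beta> <o cf r"
proof (rule ccontr)
  assume "\<not> \<beta> <o cf r"
  then have "cf r \<le>o \<beta>" using not_ordLess_iff_ordLeq[OF Well_order_cf Well_order_\<beta>] by blast
  then have "|Field (cf r)| \<le>o |Field \<beta>|" by (rule card_of_mono2)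
  moreover have "Field (cf r) \<noteq> {}" using Cinfinite_cf unfolding cinfinite_def by auto
  ultimately obtain h where h_image: "h ` Field \<beta> = Field (cf r)"
    using card_of_ordLeq2[of "Field (cf r)" "Field \<beta>"] by blast
  let ?F = "Func (Field \<beta>) (Field r)"
  have "|?F| \<le>o |Field r|" using exp_le r by (simp add: cexp_def ordLeq_card_of_Field_iff)
  then obtain e where e_inj: "inj_on e ?F" and e_image: "e ` ?F \<subseteq> Field r"
    using card_of_ordLeq by metis
  have "\<exists>v\<in>Field r. \<forall>f\<in>?F. e f \<in> underS r (h b) \<longrightarrow> f b \<noteq> v" if b_in_Field: "b \<in> Field \<beta>" for b
  proof -
    let ?D = "{f\<in>?F. e f \<in> underS r (h b)}"
    have "h b \<in> Field r" using b_in_Field h_image Field_cf_subset by blast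
    have "inj_on e ?D" by (rule inj_on_subset[OF e_inj]) blast
    moreover have "e ` ?D \<subseteq> underS r (h b)" by blast
    moreover have "|underS r (h b)| <o r" using r \<open>h b \<in> Field r\<close> by (simp add: card_of_underS)
    ultimately have "|?D| <o r" by (rule card_of_inj_ordLess)
    then have "\<not> Field r \<subseteq> (\<lambda>f. f b) ` ?D"
      using r by (simp add: Field_not_subset_ordLess card_of_image_ordLess)
    then obtain v where "v \<in> Field r" "v \<notin> (\<lambda>f. f b) ` ?D" by blast
    then show ?thesis by (intro bexI[of _ v]) auto
  qed
  then obtain v where v_in_Field: "\<And>b. b \<in> Field \<beta> \<Longrightarrow> v b \<in> Field r"
    and v_diagonal: "\<And>b f. b \<in> Field \<beta> \<Longrightarrow> f \<in> ?F \<Longrightarrow> e f \<in> underS r (h b) \<Longrightarrow> f b \<noteq> v b" by metis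
  let ?v = "\<lambda>b. if b \<in> Field \<beta> then v b else undefined"
  have v_Func: "?v \<in> ?F" using v_in_Field unfolding Func_def by auto
  then have "e ?v \<in> Field r" using e_image by blast
  then obtain k where "k \<in> Field (cf r)" "e ?v \<in> underS r k" using cf_exceeds by blast
  moreover from this obtain b where "b \<in> Field \<beta>" "k = h b" using h_image by blast
  ultimately show False using v_diagonal[OF _ v_Func] by auto
qed

end

section \<open>Eventually different functions\<close>

definition eventually_different :: "'a rel \<Rightarrow> ('a \<Rightarrow> 'b) \<Rightarrow> ('a \<Rightarrow> 'b) \<Rightarrow> bool" where
  "eventually_different r f g \<longleftrightarrow> (\<exists>b\<in>Field r. \<forall>z. (b, z) \<in> r \<longrightarrow> f z \<noteq> g z)"

definition disjointifies :: "'a rel \<Rightarrow> ('i \<Rightarrow> 'a \<Rightarrow> 'b) \<Rightarrow> 'i set \<Rightarrow> ('i \<Rightarrow> 'a) \<Rightarrow> bool" where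
  "disjointifies r f U h \<longleftrightarrow> (\<forall>\<beta>\<in>U. h \<beta> \<in> Field r) \<and>
    (\<forall>\<beta>\<in>U. \<forall>\<gamma>\<in>U. \<beta> \<noteq> \<gamma> \<longrightarrow> (\<forall>z. (h \<beta>, z) \<in> r \<longrightarrow> (h \<gamma>, z) \<in> r \<longrightarrow> f \<beta> z \<noteq> f \<gamma> z))"

lemma eventually_different_sym: "eventually_different r f g \<Longrightarrow> eventually_different r g f"
  unfolding eventually_different_def by metis

lemma card_of_underS_cardSuc:
  assumes "Card_order r" "\<alpha> \<in> Field (cardSuc r)"
  shows "|underS (cardSuc r) \<alpha>| \<le>o r"
  using card_of_underS[OF cardSuc_Card_order[OF assms(1)] assms(2)]
    cardSuc_ordLeq_ordLess[OF assms(1) card_of_Card_order] by blast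

lemma not_card_of_Field_cardSuc_ordLeq: "Card_order r \<Longrightarrow> \<not> |Field (cardSuc r)| \<le>o r"
  using not_card_of_Field_ordLess[OF cardSuc_Card_order]
    cardSuc_ordLeq_ordLess[OF _ card_of_Card_order] by blast

text \<open>
  Fix injections \<open>g \<alpha>\<close> of \<open>\<alpha> < r\<^sup>+\<close> into \<open>r\<close>; the value \<open>f \<alpha> z\<close> only has to avoid the fewer than
  \<open>r\<close> many values \<open>f \<beta> z\<close> with \<open>g \<alpha> \<beta> \<le> z\<close>.
\<close>

lemma eventually_different_family:
  assumes Cinfinite_r: "Cinfinite r"
  shows "\<exists>f. (\<forall>\<alpha>\<in>Field (cardSuc r). \<forall>z. f \<alpha> z \<in> Field r) \<and>
    pairwise (\<lambda>\<alpha> \<beta>. eventually_different r (f \<alpha>) (f \<beta>)) (Field (cardSuc r))"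
proof -
  let ?s = "cardSuc r"
  have Well_order_s: "Well_order ?s" using Cinfinite_r cardSuc_Well_order by blast
  have "\<exists>g. inj_on g (underS ?s \<alpha>) \<and> g ` underS ?s \<alpha> \<subseteq> Field r" if "\<alpha> \<in> Field ?s" for \<alpha>
    using card_of_underS_cardSuc[OF _ that] Cinfinite_r
    by (simp add: card_of_ordLeq ordLeq_card_of_Field_iff)
  then obtain g
    where g_inj: "\<And>\<alpha>. \<alpha> \<in> Field ?s \<Longrightarrow> inj_on (g \<alpha>) (underS ?s \<alpha>) \<and> g \<alpha> ` underS ?s \<alpha> \<subseteq> Field r"
    by metis
  define D where "D z \<alpha> = {\<beta>\<in>underS ?s \<alpha>. (g \<alpha> \<beta>, z) \<in> r}" for z \<alpha>
  have "\<exists>f. \<forall>\<alpha>\<in>Field ?s. f \<alpha> \<in> Field r \<and> f \<alpha> \<notin> f ` D z \<alpha>" for z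
  proof (rule Well_order_choice_avoiding[OF Well_order_s])
    fix \<alpha> assume \<alpha>_in_Field: "\<alpha> \<in> Field ?s"
    have "inj_on (g \<alpha>) (D z \<alpha>)" "g \<alpha> ` D z \<alpha> \<subseteq> under r z"
      using g_inj[OF \<alpha>_in_Field] by (auto simp: D_def under_def intro: inj_on_subset)
    moreover have "|under r z| <o r"
    proof (cases "z \<in> Field r")
      case False
      then have "under r z = {}" by (auto simp: under_def Field_def)
      then show ?thesis using Cinfinite_r by (simp add: finite_ordLess_Cinfinite)
    qed (rule card_of_under[OF Cinfinite_r])
    ultimately have "|D z \<alpha>| <o r" by (rule card_of_inj_ordLess)
    then show "|D z \<alpha>| <o |Field r|" using Cinfinite_r by (simp add: ordLess_card_of_Field_iff)
  qed (auto simp: D_def)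
  then obtain f where f_avoids: "\<And>z \<alpha>. \<alpha> \<in> Field ?s \<Longrightarrow> f z \<alpha> \<in> Field r \<and> f z \<alpha> \<notin> f z ` D z \<alpha>"
    by metis
  have "eventually_different r (\<lambda>z. f z \<alpha>) (\<lambda>z. f z \<beta>)" if "\<beta> \<in> underS ?s \<alpha>" for \<alpha> \<beta>
    unfolding eventually_different_def
  proof (intro bexI[of _ "g \<alpha> \<beta>"] allI impI)
    have \<alpha>_in_Field: "\<alpha> \<in> Field ?s" using underS_imp_Field[OF that] by blast
    show "g \<alpha> \<beta> \<in> Field r" using g_inj[OF \<alpha>_in_Field] that by blast
    show "f z \<alpha> \<noteq> f z \<beta>" if "(g \<alpha> \<beta>, z) \<in> r" for z
      using f_avoids[OF \<alpha>_in_Field, of z] that \<open>\<beta> \<in> underS ?s \<alpha>\<close> unfolding D_def by auto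
  qed
  then have "pairwise (\<lambda>\<alpha> \<beta>. eventually_different r (\<lambda>z. f z \<alpha>) (\<lambda>z. f z \<beta>)) (Field ?s)"
    using eventually_different_sym by (rule pairwise_Field[OF Well_order_s])
  with f_avoids show ?thesis by (intro exI[of _ "\<lambda>\<alpha> z. f z \<alpha>"]) blast
qed

lemma disjointifies_exists:
  assumes Cinfinite_r: "Cinfinite r" and regularCard_r: "regularCard r" and card_U: "|U| \<le>o r"
    and diff: "pairwise (\<lambda>\<beta> \<gamma>. eventually_different r (f \<beta>) (f \<gamma>)) U"
  shows "\<exists>h. disjointifies r f U h"
proof -
  have Well_order_r: "Well_order r" using Cinfinite_r card_order_on_well_order_on by blast
  obtain p where p_inj: "inj_on p U" and p_image: "p ` U \<subseteq> Field r"
    using card_U Cinfinite_r by (metis card_of_ordLeq ordLeq_card_of_Field_iff)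
  have "\<forall>\<beta> \<gamma>. \<exists>b. \<beta> \<in> U \<longrightarrow> \<gamma> \<in> U \<longrightarrow> \<beta> \<noteq> \<gamma> \<longrightarrow> b \<in> Field r \<and> (\<forall>z. (b, z) \<in> r \<longrightarrow> f \<beta> z \<noteq> f \<gamma> z)"
    using diff unfolding pairwise_def eventually_different_def by blast
  then obtain b where b_in_Field: "\<And>\<beta> \<gamma>. \<beta> \<in> U \<Longrightarrow> \<gamma> \<in> U \<Longrightarrow> \<beta> \<noteq> \<gamma> \<Longrightarrow> b \<beta> \<gamma> \<in> Field r"
    and b_separates: "\<And>\<beta> \<gamma> z. \<beta> \<in> U \<Longrightarrow> \<gamma> \<in> U \<Longrightarrow> \<beta> \<noteq> \<gamma> \<Longrightarrow> (b \<beta> \<gamma>, z) \<in> r \<Longrightarrow> f \<beta> z \<noteq> f \<gamma> z" by metis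
  define D where "D \<beta> = {\<gamma>\<in>U - {\<beta>}. (p \<gamma>, p \<beta>) \<in> r}" for \<beta>
  have "\<exists>h\<in>Field r. \<forall>\<gamma>\<in>D \<beta>. b \<beta> \<gamma> \<in> underS r h" if \<beta>_in_U: "\<beta> \<in> U" for \<beta>
  proof -
    have "inj_on p (D \<beta>)" "p ` D \<beta> \<subseteq> under r (p \<beta>)"
      using p_inj by (auto simp: D_def under_def intro: inj_on_subset)
    moreover have "|under r (p \<beta>)| <o r" using card_of_under[OF Cinfinite_r] p_image \<beta>_in_U by blast
    ultimately have "|D \<beta>| <o r" by (rule card_of_inj_ordLess)
    then have "|b \<beta> ` D \<beta>| <o r" by (rule card_of_image_ordLess)
    moreover have "b \<beta> ` D \<beta> \<subseteq> Field r" using b_in_Field \<beta>_in_U unfolding D_def by blast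
    ultimately show ?thesis
      using regularCard_bounded[OF Cinfinite_r regularCard_r, of "b \<beta> ` D \<beta>"] by blast
  qed
  then obtain h where h_in_Field: "\<And>\<beta>. \<beta> \<in> U \<Longrightarrow> h \<beta> \<in> Field r"
    and b_less_h: "\<And>\<beta> \<gamma>. \<beta> \<in> U \<Longrightarrow> \<gamma> \<in> D \<beta> \<Longrightarrow> b \<beta> \<gamma> \<in> underS r (h \<beta>)" by metis
  have separated: "f \<beta> z \<noteq> f \<gamma> z" if "\<beta> \<in> U" "\<gamma> \<in> D \<beta>" "(h \<beta>, z) \<in> r" for \<beta> \<gamma> z
  proof (rule b_separates)
    show "(b \<beta> \<gamma>, z) \<in> r"
      using Well_order_trans[OF Well_order_r underS_imp_le[OF b_less_h] that(3)] that(1,2) by blast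
  qed (use that in \<open>auto simp: D_def\<close>)
  have "f \<beta> z \<noteq> f \<gamma> z"
    if "\<beta> \<in> U" "\<gamma> \<in> U" "\<beta> \<noteq> \<gamma>" "(h \<beta>, z) \<in> r" "(h \<gamma>, z) \<in> r" for \<beta> \<gamma> z
  proof (cases "(p \<beta>, p \<gamma>) \<in> r")
    case True
    then have "\<beta> \<in> D \<gamma>" using that unfolding D_def by blast
    then show ?thesis using separated[OF that(2) _ that(5)] by metis
  next
    case False
    then have "(p \<gamma>, p \<beta>) \<in> r"
      using that p_image Well_order_not_le_iff[OF Well_order_r] underS_imp_le[of _ r] by blast
    then have "\<gamma> \<in> D \<beta>" using that unfolding D_def by blast
    then show ?thesis using separated[OF that(1) _ that(4)] by blast
  qed
  then show ?thesis using h_in_Field unfolding disjointifies_def by blast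
qed

section \<open>Ideals closed under unions of \<open>\<mu>\<close> many sets\<close>

locale succ_complete_ideal =
  fixes \<mu> :: "'a rel" and X :: "'x set" and I :: "'x set set"
  assumes Cinfinite_\<mu>: "Cinfinite \<mu>"
    and ideal: "ideal_on X I"
    and complete: "complete_ideal (cardSuc \<mu>) I"
begin

abbreviation pos :: "'x set set" where
  "pos \<equiv> positive_sets X I"

definition pos_refinement :: "'i set \<Rightarrow> ('i \<Rightarrow> 'x set) \<Rightarrow> ('i \<Rightarrow> 'x set) \<Rightarrow> bool" where
  "pos_refinement J B A \<longleftrightarrow> (\<forall>i\<in>J. B i \<in> pos \<and> B i \<subseteq> A i)"

definition dense_below :: "('x set \<Rightarrow> bool) \<Rightarrow> 'x set \<Rightarrow> bool" where
  "dense_below P q \<longleftrightarrow> (\<forall>q'\<subseteq>q. q' \<in> pos \<longrightarrow> (\<exists>p\<subseteq>q'. p \<in> pos \<and> P p))"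

lemma Card_order_\<mu>: "Card_order \<mu>" and Well_order_\<mu>: "Well_order \<mu>"
  and infinite_\<mu>: "infinite (Field \<mu>)"
  using Cinfinite_\<mu> card_order_on_well_order_on by (auto simp: cinfinite_def)

lemma null_empty: "{} \<in> I"
  using ideal unfolding ideal_on_def by blast

lemma null_subset: "B \<in> I \<Longrightarrow> A \<subseteq> B \<Longrightarrow> A \<in> I"
  using ideal unfolding ideal_on_def by blast

lemma null_Un: "A \<in> I \<Longrightarrow> B \<in> I \<Longrightarrow> A \<union> B \<in> I"
  using ideal unfolding ideal_on_def by blast

lemma null_UN:
  assumes "|J| \<le>o \<mu>" "\<And>j. j \<in> J \<Longrightarrow> N j \<in> I"
  shows "(\<Union>j\<in>J. N j) \<in> I"
proof -
  have "|N ` J| <o cardSuc \<mu>"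
    using card_of_image_ordLeq[OF assms(1)]
      cardSuc_ordLeq_ordLess[OF Card_order_\<mu> card_of_Card_order]
    by blast
  then show ?thesis using complete assms(2) unfolding complete_ideal_def by blast
qed

lemma pos_iff: "A \<in> pos \<longleftrightarrow> A \<subseteq> X \<and> A \<notin> I"
  unfolding positive_sets_def by blast

lemma pos_superset: "A \<in> pos \<Longrightarrow> A \<subseteq> B \<Longrightarrow> B \<subseteq> X \<Longrightarrow> B \<in> pos"
  using null_subset unfolding pos_iff by blast

lemma pos_Diff_null:
  assumes "A \<in> pos" "N \<in> I"
  shows "A - N \<in> pos"
proof -
  have "A \<subseteq> (A - N) \<union> N" by blast
  then show ?thesis using assms null_Un null_subset unfolding pos_iff by blast
qed

lemma pos_nonempty: "A \<in> pos \<Longrightarrow> A \<noteq> {}"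
  using null_empty unfolding pos_iff by blast

lemma pos_pigeonhole:
  assumes "A \<in> pos" "|P| \<le>o \<mu>" "\<And>x. x \<in> A \<Longrightarrow> \<exists>p\<in>P. R x p"
  shows "\<exists>p\<in>P. {x\<in>A. R x p} \<in> pos"
proof (rule ccontr)
  assume "\<not> ?thesis"
  then have "(\<Union>p\<in>P. {x\<in>A. R x p}) \<in> I"
    using assms(1) unfolding pos_iff by (intro null_UN[OF assms(2)]) blast
  moreover have "A \<subseteq> (\<Union>p\<in>P. {x\<in>A. R x p})" using assms(3) by blast
  ultimately show False using assms(1) null_subset unfolding pos_iff by blast
qed

lemma pos_refinement_trans:
  "pos_refinement J C B \<Longrightarrow> pos_refinement J B A \<Longrightarrow> pos_refinement J C A"
  unfolding pos_refinement_def by blast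

lemma dense_below_mono: "dense_below P q \<Longrightarrow> q' \<subseteq> q \<Longrightarrow> dense_below P q'"
  unfolding dense_below_def by blast

lemma dense_belowD: "dense_below P q \<Longrightarrow> q \<in> pos \<Longrightarrow> \<exists>p\<subseteq>q. p \<in> pos \<and> P p"
  unfolding dense_below_def by blast

lemma disjoint_pos_refinement:
  assumes Well_order_r: "Well_order r" and small: "\<And>i. i \<in> Field r \<Longrightarrow> |underS r i| \<le>o \<mu>"
    and B_pos: "\<And>i. i \<in> Field r \<Longrightarrow> B i \<in> pos"
  shows "\<exists>C. pos_refinement (Field r) C B \<and>
    pairwise (\<lambda>i j. B i \<inter> B j \<in> I \<longrightarrow> C i \<inter> C j = {}) (Field r)"
proof -
  define S where "S i = {j\<in>underS r i. B i \<inter> B j \<in> I}" for i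
  define C where "C i = B i - (\<Union>j\<in>S i. B i \<inter> B j)" for i
  have "C i \<in> pos" if "i \<in> Field r" for i
    unfolding C_def
  proof (intro pos_Diff_null null_UN B_pos that)
    show "|S i| \<le>o \<mu>" by (rule card_of_subset_ordLeq[OF _ small[OF that]]) (auto simp: S_def)
  qed (auto simp: S_def)
  then have "pos_refinement (Field r) C B" unfolding pos_refinement_def C_def by blast
  moreover have "pairwise (\<lambda>i j. B i \<inter> B j \<in> I \<longrightarrow> C i \<inter> C j = {}) (Field r)"
  proof (rule pairwise_Field[OF Well_order_r])
    show "B i \<inter> B j \<in> I \<longrightarrow> C i \<inter> C j = {}" if "j \<in> underS r i" for i j
      using that unfolding C_def S_def by blast
  qed (simp add: Int_commute)
  ultimately show ?thesis by blast
qed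

text \<open>
  Refine each set to a kind chosen by \<open>separating_choice\<close>: a set of a kind that is impossible below
  another one is almost disjoint from it.
\<close>

lemma refinement_by_kinds:
  assumes hereditary: "\<And>k q q'. P k q \<Longrightarrow> q' \<subseteq> q \<Longrightarrow> P k q'"
    and dense: "\<And>i. i \<in> J \<Longrightarrow> \<exists>k. \<exists>q\<subseteq>A i. q \<in> pos \<and> P k q"
  shows "\<exists>q k. pos_refinement J q A \<and> (\<forall>i\<in>J. P (k i) (q i)) \<and>
    pairwise (\<lambda>i j. k i \<noteq> k j \<longrightarrow> q i \<inter> q j \<in> I) J"
proof -
  define S where "S i = {k. \<exists>q\<subseteq>A i. q \<in> pos \<and> P k q}" for i
  have "S i \<noteq> {}" if "i \<in> J" for i using dense[OF that] unfolding S_def by blast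
  then obtain k where k_in_S: "\<And>i. i \<in> J \<Longrightarrow> k i \<in> S i"
    and k_separates: "\<And>i j. i \<in> J \<Longrightarrow> j \<in> J \<Longrightarrow> k i \<noteq> k j \<Longrightarrow> k i \<notin> S j \<or> k j \<notin> S i"
    using separating_choice[of J S] by blast
  then obtain q where q_kind: "\<And>i. i \<in> J \<Longrightarrow> q i \<subseteq> A i \<and> q i \<in> pos \<and> P (k i) (q i)"
    unfolding S_def mem_Collect_eq by metis
  have impossible: "q i \<inter> q j \<in> I" if "i \<in> J" "j \<in> J" "k i \<notin> S j" for i j
  proof (rule ccontr)
    assume "q i \<inter> q j \<notin> I"
    then have "q i \<inter> q j \<in> pos" using q_kind[OF that(1)] unfolding pos_iff by blast
    moreover have "P (k i) (q i \<inter> q j)" using q_kind[OF that(1)] hereditary by blast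
    ultimately show False using that(3) q_kind[OF that(2)] unfolding S_def by blast
  qed
  have "q i \<inter> q j \<in> I" if "i \<in> J" "j \<in> J" "k i \<noteq> k j" for i j
    using k_separates[OF that] impossible[of i j] impossible[of j i] that
    by (auto simp: Int_commute)
  then show ?thesis using q_kind unfolding pos_refinement_def pairwise_def by blast
qed

subsection \<open>Refinements from matrices with almost disjoint columns\<close>

lemma heavy_value_exists:
  assumes Cinfinite_\<rho>: "Cinfinite \<rho>" and \<mu>_le_\<rho>: "\<mu> \<le>o \<rho>" and card_\<Phi>: "|\<Phi>| \<le>o \<mu>"
    and big_\<Lambda>: "\<not> |\<Lambda>| \<le>o \<rho>"
    and A_pos: "A \<in> pos" and E_in_\<Phi>: "\<And>x \<alpha>. x \<in> X \<Longrightarrow> \<alpha> \<in> \<Lambda> \<Longrightarrow> E x \<alpha> \<in> \<Phi>"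
  shows "\<exists>\<phi>\<in>\<Phi>. \<not> |{\<alpha>\<in>\<Lambda>. {x\<in>A. E x \<alpha> = \<phi>} \<in> pos}| \<le>o \<rho>"
proof (rule ccontr)
  let ?T = "\<lambda>\<phi>. {\<alpha>\<in>\<Lambda>. {x\<in>A. E x \<alpha> = \<phi>} \<in> pos}"
  assume "\<not> ?thesis"
  then have "|\<Union>\<phi>\<in>\<Phi>. ?T \<phi>| \<le>o \<rho>"
    using ordLeq_transitive[OF card_\<Phi> \<mu>_le_\<rho>] by (intro UNION_Cinfinite_bound Cinfinite_\<rho>) auto
  moreover have "\<Lambda> \<subseteq> (\<Union>\<phi>\<in>\<Phi>. ?T \<phi>)"
  proof
    fix \<alpha> assume "\<alpha> \<in> \<Lambda>"
    then have "\<exists>\<phi>\<in>\<Phi>. {x\<in>A. E x \<alpha> = \<phi>} \<in> pos"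
      using E_in_\<Phi> A_pos unfolding pos_iff[of A] by (intro pos_pigeonhole[OF A_pos card_\<Phi>]) blast
    then show "\<alpha> \<in> (\<Union>\<phi>\<in>\<Phi>. ?T \<phi>)" using \<open>\<alpha> \<in> \<Lambda>\<close> by blast
  qed
  ultimately show False using big_\<Lambda> card_of_subset_ordLeq by blast
qed

lemma injective_heavy_choice:
  assumes Cinfinite_\<rho>: "Cinfinite \<rho>" and card_J: "|J| \<le>o \<rho>" and card_\<Phi>: "|\<Phi>| \<le>o \<rho>"
    and heavy: "\<And>i. i \<in> J \<Longrightarrow> \<not> |T i (\<pi> i)| \<le>o \<rho>"
  shows "\<exists>g. inj_on g J \<and>
    (\<forall>i\<in>J. g i \<in> T i (\<pi> i) \<and> (\<forall>j\<in>J. \<forall>\<phi>\<in>\<Phi>. g i \<in> T j \<phi> \<longrightarrow> \<not> |T j \<phi>| \<le>o \<rho>))"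
proof -
  define light where "light = (\<Union>j\<in>J. \<Union>\<phi>\<in>{\<phi>\<in>\<Phi>. |T j \<phi>| \<le>o \<rho>}. T j \<phi>)"
  have light_j: "|\<Union>\<phi>\<in>{\<phi>\<in>\<Phi>. |T j \<phi>| \<le>o \<rho>}. T j \<phi>| \<le>o \<rho>" for j
    by (rule UNION_Cinfinite_bound[OF card_of_subset_ordLeq[OF _ card_\<Phi>] _ Cinfinite_\<rho>]) auto
  have light: "|light| \<le>o \<rho>"
    unfolding light_def using card_J light_j Cinfinite_\<rho> by (intro UNION_Cinfinite_bound) blast+
  have "|J| <o |T i (\<pi> i) - light|" if "i \<in> J" for i
  proof -
    have "\<not> |(T i (\<pi> i) - light) \<union> light| \<le>o \<rho>"
      using heavy[OF that] card_of_subset_ordLeq[of "T i (\<pi> i)" "(T i (\<pi> i) - light) \<union> light"]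
      by blast
    then have "\<not> |T i (\<pi> i) - light| \<le>o \<rho>" using Un_Cinfinite_bound[OF _ light Cinfinite_\<rho>] by blast
    then show ?thesis using not_card_of_ordLeq_iff Cinfinite_\<rho> card_J ordLeq_ordLess_trans by blast
  qed
  then obtain g where g_inj: "inj_on g J" and g_heavy: "\<And>i. i \<in> J \<Longrightarrow> g i \<in> T i (\<pi> i) - light"
    using injective_choice[of J "\<lambda>i. T i (\<pi> i) - light"] by blast
  have "\<not> |T j \<phi>| \<le>o \<rho>" if "i \<in> J" "j \<in> J" "\<phi> \<in> \<Phi>" "g i \<in> T j \<phi>" for i j \<phi>
    using g_heavy[OF that(1)] that(2-4) unfolding light_def by blast
  with g_inj g_heavy show ?thesis by blast
qed

text \<open>
  Column \<open>\<alpha>\<close> of the matrix \<open>E\<close> splits \<open>A i\<close> into at most \<open>\<mu>\<close> pieces. Each \<open>A i\<close> keeps a piece whose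
  value \<open>\<pi> i\<close> is heavy, i.e. positive in more than \<open>\<rho>\<close> columns. Pieces with equal values are almost
  disjoint if their columns differ; of two different values one is not heavy for the other set, and
  its column avoids the at most \<open>\<rho>\<close> columns in which it is positive there.
\<close>

lemma matrix_refinement:
  assumes Cinfinite_\<rho>: "Cinfinite \<rho>" and \<mu>_le_\<rho>: "\<mu> \<le>o \<rho>" and card_J: "|J| \<le>o \<rho>"
    and card_\<Phi>: "|\<Phi>| \<le>o \<mu>" and big_\<Lambda>: "\<not> |\<Lambda>| \<le>o \<rho>"
    and E_in_\<Phi>: "\<And>x \<alpha>. x \<in> X \<Longrightarrow> \<alpha> \<in> \<Lambda> \<Longrightarrow> E x \<alpha> \<in> \<Phi>"
    and A_pos: "\<And>i. i \<in> J \<Longrightarrow> A i \<in> pos"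
    and diff: "\<And>i. i \<in> J \<Longrightarrow> pairwise (\<lambda>\<alpha> \<beta>. {x\<in>A i. E x \<alpha> = E x \<beta>} \<in> I) \<Lambda>"
  shows "\<exists>B. pos_refinement J B A \<and> pairwise (\<lambda>i j. B i \<inter> B j \<in> I) J"
proof -
  define T where "T i \<phi> = {\<alpha>\<in>\<Lambda>. {x\<in>A i. E x \<alpha> = \<phi>} \<in> pos}" for i \<phi>
  define S where "S i = {\<phi>\<in>\<Phi>. \<not> |T i \<phi>| \<le>o \<rho>}" for i
  have "S i \<noteq> {}" if "i \<in> J" for i
    using heavy_value_exists[OF Cinfinite_\<rho> \<mu>_le_\<rho> card_\<Phi> big_\<Lambda> A_pos[OF that], of E] E_in_\<Phi>
    unfolding S_def T_def by blast
  then obtain \<pi> where \<pi>_in_S: "\<And>i. i \<in> J \<Longrightarrow> \<pi> i \<in> S i"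
    and \<pi>_separates: "\<And>i j. i \<in> J \<Longrightarrow> j \<in> J \<Longrightarrow> \<pi> i \<noteq> \<pi> j \<Longrightarrow> \<pi> i \<notin> S j \<or> \<pi> j \<notin> S i"
    using separating_choice[of J S] by blast
  have "\<exists>g. inj_on g J \<and> (\<forall>i\<in>J. g i \<in> T i (\<pi> i) \<and>
      (\<forall>j\<in>J. \<forall>\<phi>\<in>\<Phi>. g i \<in> T j \<phi> \<longrightarrow> \<not> |T j \<phi>| \<le>o \<rho>))"
    using \<pi>_in_S ordLeq_transitive[OF card_\<Phi> \<mu>_le_\<rho>]
    by (intro injective_heavy_choice[OF Cinfinite_\<rho> card_J]) (auto simp: S_def)
  then obtain g where g_inj: "inj_on g J" and g_column: "\<And>i. i \<in> J \<Longrightarrow> g i \<in> T i (\<pi> i)"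
    and g_heavy: "\<And>i j \<phi>. i \<in> J \<Longrightarrow> j \<in> J \<Longrightarrow> \<phi> \<in> \<Phi> \<Longrightarrow> g i \<in> T j \<phi> \<Longrightarrow> \<phi> \<in> S j"
    unfolding S_def by blast
  define B where "B i = {x\<in>A i. E x (g i) = \<pi> i}" for i
  have refinement: "pos_refinement J B A"
    using g_column unfolding pos_refinement_def B_def T_def by blast
  have not_heavy: "B i \<inter> B j \<in> I" if "i \<in> J" "j \<in> J" "\<pi> i \<notin> S j" for i j
  proof -
    have "g i \<notin> T j (\<pi> i)" "g i \<in> \<Lambda>"
      using g_column g_heavy[OF that(1)] \<pi>_in_S[OF that(1)] that unfolding T_def S_def by blast+
    then have "{x\<in>A j. E x (g i) = \<pi> i} \<in> I"
      using A_pos[OF that(2)] unfolding T_def pos_iff by blast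
    then show ?thesis by (rule null_subset) (auto simp: B_def)
  qed
  have "B i \<inter> B j \<in> I" if i_in_J: "i \<in> J" and j_in_J: "j \<in> J" and i_neq_j: "i \<noteq> j" for i j
  proof (cases "\<pi> i = \<pi> j")
    case True
    have "g i \<noteq> g j" "g i \<in> \<Lambda>" "g j \<in> \<Lambda>"
      using g_inj g_column g_heavy i_in_J j_in_J i_neq_j unfolding inj_on_def T_def by blast+
    then have "{x\<in>A i. E x (g i) = E x (g j)} \<in> I"
      using diff[OF i_in_J] unfolding pairwise_def by blast
    then show ?thesis by (rule null_subset) (use True in \<open>auto simp: B_def\<close>)
  next
    case False
    then show ?thesis
      using \<pi>_separates[OF i_in_J j_in_J] not_heavy[of i j] not_heavy[of j i] i_in_J j_in_J i_neq_j
      by (auto simp: Int_commute)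
  qed
  with refinement show ?thesis unfolding pairwise_def by blast
qed

end

section \<open>Complete ideals on a successor cardinal\<close>

locale ideal_on_succ_cardinal =
  fixes \<mu> :: "'a rel" and \<kappa> :: "'k rel" and I :: "'k set set"
  assumes Cinfinite_\<mu>: "Cinfinite \<mu>"
    and \<kappa>: "\<kappa> =o cardSuc \<mu>"
    and ideal: "ideal_on (Field \<kappa>) I"
    and nonprincipal: "nonprincipal_ideal (Field \<kappa>) I"
    and complete: "complete_ideal \<kappa> I"

sublocale ideal_on_succ_cardinal \<subseteq> succ_complete_ideal \<mu> "Field \<kappa>" I
proof
  show "complete_ideal (cardSuc \<mu>) I"
    using complete ordLess_ordIso_trans[OF _ ordIso_symmetric[OF \<kappa>]]
    unfolding complete_ideal_def by blast
qed (rule Cinfinite_\<mu> ideal)+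

context ideal_on_succ_cardinal
begin

abbreviation X :: "'k set" where "X \<equiv> Field \<kappa>"

lemma Cinfinite_\<kappa>: "Cinfinite \<kappa>"
  by (rule Cinfinite_cong[OF ordIso_symmetric[OF \<kappa>] Cinfinite_cardSuc[OF Cinfinite_\<mu>]])

lemma Card_order_\<kappa>: "Card_order \<kappa>" and Well_order_\<kappa>: "Well_order \<kappa>"
  using Cinfinite_\<kappa> card_order_on_well_order_on by blast+

lemma regularCard_\<kappa>: "regularCard \<kappa>"
  by (rule regularCard_ordIso[OF ordIso_symmetric[OF \<kappa>]])
    (simp_all add: Cinfinite_\<mu> Cinfinite_cardSuc regularCard_cardSuc)

lemma ordLess_\<kappa>_iff: "|A| <o \<kappa> \<longleftrightarrow> |A| \<le>o \<mu>"
  using cardSuc_ordLeq_ordLess[OF Card_order_\<mu> card_of_Card_order, of A]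
    ordLess_ordIso_trans[OF _ \<kappa>, of "|A|"]
    ordLess_ordIso_trans[OF _ ordIso_symmetric[OF \<kappa>], of "|A|"]
  by blast

lemma \<mu>_ordLeq_\<kappa>: "\<mu> \<le>o \<kappa>"
  using cardSuc_ordLeq[OF Card_order_\<mu>] \<kappa> ordLeq_ordIso_trans ordIso_symmetric by blast

lemma not_X_ordLeq_\<mu>: "\<not> |X| \<le>o \<mu>"
  using ordLess_\<kappa>_iff not_card_of_Field_ordLess[OF Card_order_\<kappa>] by blast

lemma card_of_underS_\<kappa>: "x \<in> X \<Longrightarrow> |underS \<kappa> x| \<le>o \<mu>"
  using card_of_underS[OF Card_order_\<kappa>] ordLess_\<kappa>_iff by blast

lemma card_of_under_\<kappa>: "x \<in> X \<Longrightarrow> |under \<kappa> x| \<le>o \<mu>"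
  using card_of_under[OF Cinfinite_\<kappa>] ordLess_\<kappa>_iff by blast

lemma null_small:
  assumes "A \<subseteq> X" "|A| \<le>o \<mu>"
  shows "A \<in> I"
  using null_UN[OF assms(2), of "\<lambda>a. {a}"] nonprincipal assms(1)
  unfolding nonprincipal_ideal_def by auto

lemma null_under: "x \<in> X \<Longrightarrow> under \<kappa> x \<in> I"
  by (rule null_small[OF under_Field card_of_under_\<kappa>])

definition idx :: "'k \<Rightarrow> 'k \<Rightarrow> 'a" where
  "idx x = (SOME g. inj_on g (underS \<kappa> x) \<and> range g \<subseteq> Field \<mu>)"

lemma
  assumes "x \<in> X"
  shows inj_on_idx: "inj_on (idx x) (underS \<kappa> x)" and idx_Field: "idx x y \<in> Field \<mu>"
proof -
  have "|underS \<kappa> x| \<le>o |Field \<mu>|"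
    using card_of_underS_\<kappa>[OF assms] by (simp add: ordLeq_card_of_Field_iff Card_order_\<mu>)
  then obtain g where g_inj: "inj_on g (underS \<kappa> x)" and g_image: "g ` underS \<kappa> x \<subseteq> Field \<mu>"
    using card_of_ordLeq[of "underS \<kappa> x" "Field \<mu>"] by blast
  obtain m where m_in_Field: "m \<in> Field \<mu>" using infinite_\<mu> by fastforce
  let ?g = "\<lambda>y. if y \<in> underS \<kappa> x then g y else m"
  have "inj_on ?g (underS \<kappa> x)" using g_inj by (simp add: inj_on_def)
  moreover have "range ?g \<subseteq> Field \<mu>" using g_image m_in_Field by auto
  ultimately have "inj_on (idx x) (underS \<kappa> x) \<and> range (idx x) \<subseteq> Field \<mu>"
    unfolding idx_def by (rule someI2[of _ ?g, OF conjI])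
  then show "inj_on (idx x) (underS \<kappa> x)" "idx x y \<in> Field \<mu>" by auto
qed

lemma idx_columns_almost_disjoint:
  assumes "\<alpha> \<in> X" "\<beta> \<in> X" "\<alpha> \<noteq> \<beta>"
  shows "{x\<in>X. idx x \<alpha> = idx x \<beta>} \<in> I"
proof (rule null_subset)
  show "under \<kappa> \<alpha> \<union> under \<kappa> \<beta> \<in> I" using assms(1,2) by (intro null_Un null_under)
  show "{x\<in>X. idx x \<alpha> = idx x \<beta>} \<subseteq> under \<kappa> \<alpha> \<union> under \<kappa> \<beta>"
  proof
    fix x assume "x \<in> {x\<in>X. idx x \<alpha> = idx x \<beta>}"
    then have "x \<in> X" "\<alpha> \<notin> underS \<kappa> x \<or> \<beta> \<notin> underS \<kappa> x"
      using inj_on_idx assms(3) unfolding inj_on_def by blast+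
    then show "x \<in> under \<kappa> \<alpha> \<union> under \<kappa> \<beta>"
      using Well_order_not_le_iff[OF Well_order_\<kappa>] assms(1,2) unfolding under_def by blast
  qed
qed

lemma small_disjoint_refinement:
  assumes card_J: "|J| \<le>o \<mu>" and A_pos: "\<And>i. i \<in> J \<Longrightarrow> A i \<in> pos"
  shows "\<exists>B. pos_refinement J B A \<and> disjoint_family_on B J"
proof -
  have "\<exists>B. pos_refinement J B A \<and> pairwise (\<lambda>i j. B i \<inter> B j \<in> I) J"
  proof (rule matrix_refinement[where E = idx and \<rho> = \<mu>])
    show "|Field \<mu>| \<le>o \<mu>" by (rule card_of_Field_ordLeq[OF Card_order_\<mu>])
    show "pairwise (\<lambda>\<alpha> \<beta>. {x\<in>A i. idx x \<alpha> = idx x \<beta>} \<in> I) X" if "i \<in> J" for i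
    proof (rule pairwiseI)
      fix \<alpha> \<beta> assume "\<alpha> \<in> X" "\<beta> \<in> X" "\<alpha> \<noteq> \<beta>"
      then show "{x\<in>A i. idx x \<alpha> = idx x \<beta>} \<in> I"
        using A_pos[OF that]
        by (intro null_subset[OF idx_columns_almost_disjoint]) (auto simp: pos_iff)
    qed
  qed (simp_all add: card_J A_pos Cinfinite_\<mu> Card_order_\<mu> ordLeq_refl not_X_ordLeq_\<mu> idx_Field)
  then obtain B where B_refines_A: "pos_refinement J B A"
    and B_almost_disjoint: "pairwise (\<lambda>i j. B i \<inter> B j \<in> I) J" by blast
  have "|underS |J| i| \<le>o \<mu>" for i
    using Order_Relation.underS_Field[of "|J|" i]
    by (intro card_of_subset_ordLeq[OF _ card_J]) (simp add: Field_card_of)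
  then obtain C where "pos_refinement J C B"
    "pairwise (\<lambda>i j. B i \<inter> B j \<in> I \<longrightarrow> C i \<inter> C j = {}) J"
    using disjoint_pos_refinement[OF card_of_Well_order[of J], of B] B_refines_A
    unfolding Field_card_of pos_refinement_def by blast
  then show ?thesis
    using pos_refinement_trans[OF _ B_refines_A] B_almost_disjoint
    unfolding disjoint_family_on_def pairwise_def by blast
qed

lemma card_of_component_ordLeq:
  assumes R_subset: "R \<subseteq> J \<times> J" and degree: "\<And>i. i \<in> J \<Longrightarrow> |R `` {i}| \<le>o \<mu>" and "i \<in> J"
  shows "|R\<^sup>* `` {i}| \<le>o \<mu>"
proof -
  have "|(R ^^ n) `` {i}| \<le>o \<mu> \<and> (R ^^ n) `` {i} \<subseteq> J" for n
  proof (induction n)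
    case 0
    then show ?case
      using \<open>i \<in> J\<close> by (simp add: finite_ordLess_Cinfinite[OF _ Cinfinite_\<mu>] ordLess_imp_ordLeq)
  next
    case (Suc n)
    have "(R ^^ Suc n) `` {i} = (\<Union>j\<in>(R ^^ n) `` {i}. R `` {j})" by auto
    then show ?case
      using Suc degree R_subset by (auto intro!: UNION_Cinfinite_bound[OF _ _ Cinfinite_\<mu>])
  qed
  moreover have "|UNIV :: nat set| \<le>o \<mu>"
    using natLeq_ordLeq_cinfinite[OF Cinfinite_\<mu>] card_of_nat ordIso_ordLeq_trans by blast
  ultimately have "|\<Union>n. (R ^^ n) `` {i}| \<le>o \<mu>"
    by (intro UNION_Cinfinite_bound[OF _ _ Cinfinite_\<mu>]) auto
  then show ?thesis by (rule card_of_subset_ordLeq[rotated]) (auto simp: rtrancl_power)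
qed

lemma small_degree_refinement:
  assumes R_subset: "R \<subseteq> J \<times> J" and R_sym: "sym R" and degree: "\<And>i. i \<in> J \<Longrightarrow> |R `` {i}| \<le>o \<mu>"
    and A_pos: "\<And>i. i \<in> J \<Longrightarrow> A i \<in> pos"
  shows "\<exists>B. pos_refinement J B A \<and> (\<forall>i j. (i, j) \<in> R \<longrightarrow> i \<noteq> j \<longrightarrow> B i \<inter> B j = {})"
proof -
  define K where "K i = R\<^sup>* `` {i}" for i
  have K_subset_J: "K i \<subseteq> J" and card_K: "|K i| \<le>o \<mu>" if "i \<in> J" for i
    using that R_subset card_of_component_ordLeq[OF R_subset degree] unfolding K_def
    by (auto elim: rtranclE)
  have "\<exists>B. pos_refinement C B A \<and> disjoint_family_on B C" if "C \<in> K ` J" for C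
    using that K_subset_J card_K A_pos small_disjoint_refinement[of C A] by blast
  then obtain B
    where B_components: "\<And>C. C \<in> K ` J \<Longrightarrow> pos_refinement C (B C) A \<and> disjoint_family_on (B C) C"
    by metis
  have K_self: "i \<in> K i" for i unfolding K_def by blast
  have K_eq: "K i = K j" if "(i, j) \<in> R" for i j
    using that symD[OF R_sym that] unfolding K_def by (auto intro: converse_rtrancl_into_rtrancl)
  have "pos_refinement J (\<lambda>i. B (K i) i) A"
    using B_components K_self unfolding pos_refinement_def by blast
  moreover have "B (K i) i \<inter> B (K j) j = {}" if "(i, j) \<in> R" "i \<noteq> j" for i j
  proof -
    have "i \<in> J" using that R_subset by blast
    then show ?thesis
      using B_components[of "K i"] K_self[of i] K_self[of j] K_eq[OF that(1)] that(2)
      unfolding disjoint_family_on_def by auto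
  qed
  ultimately show ?thesis by (intro exI[of _ "\<lambda>i. B (K i) i"]) blast
qed

end

section \<open>Cofinal sequences in the generic ultrapower\<close>

text \<open>This holds as soon as the cofinality of \<open>C\<close> differs from that of \<open>r\<close>.\<close>

definition cofinally_bounded :: "'a rel \<Rightarrow> 'a set \<Rightarrow> bool" where
  "cofinally_bounded r C \<longleftrightarrow> (\<forall>s\<in>C \<rightarrow> Field r.
     \<exists>\<xi>\<in>Field r. \<forall>c\<in>C. \<exists>d\<in>C. (c, d) \<in> r \<and> s d \<in> underS r \<xi>)"

context ideal_on_succ_cardinal
begin

definition densely_constant :: "('k \<Rightarrow> 'k) \<Rightarrow> 'k set \<Rightarrow> bool" where
  "densely_constant g = dense_below (\<lambda>p. \<exists>\<gamma>\<in>X. \<forall>x\<in>p. g x = \<gamma>)"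

definition increasing_sequence :: "'a set \<Rightarrow> ('a \<Rightarrow> 'k) \<Rightarrow> bool" where
  "increasing_sequence C \<zeta> \<longleftrightarrow>
    \<zeta> \<in> C \<rightarrow> X \<and> (\<forall>c\<in>C. \<forall>d\<in>C. (c, d) \<in> \<mu> \<longrightarrow> (\<zeta> c, \<zeta> d) \<in> \<kappa>)"

definition unbounded_over :: "'a set \<Rightarrow> ('k \<Rightarrow> 'a \<Rightarrow> 'k) \<Rightarrow> 'k set \<Rightarrow> bool" where
  "unbounded_over C z q \<longleftrightarrow> (\<forall>\<gamma>\<in>X. {x\<in>q. \<forall>c\<in>C. (z x c, \<gamma>) \<in> \<kappa>} \<in> I)"

text \<open>
  The functions \<open>\<lambda>x. z x c\<close> represent, below the condition \<open>q\<close>, a sequence of ordinals below \<open>\<kappa>\<close> in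
  the generic ultrapower that is cofinal in \<open>\<kappa>\<close>.
\<close>

definition cofinal_sequence :: "'a set \<Rightarrow> ('k \<Rightarrow> 'a \<Rightarrow> 'k) \<Rightarrow> 'k set \<Rightarrow> bool" where
  "cofinal_sequence C z q \<longleftrightarrow> C \<subseteq> Field \<mu> \<and> |C| <o \<mu> \<and>
     (\<forall>x\<in>q. increasing_sequence C (z x)) \<and>
     (\<forall>c\<in>C. densely_constant (\<lambda>x. z x c) q) \<and>
     unbounded_over C z q"

lemma densely_constantD:
  "densely_constant g q \<Longrightarrow> p \<subseteq> q \<Longrightarrow> p \<in> pos \<Longrightarrow> \<exists>p'\<subseteq>p. p' \<in> pos \<and> (\<exists>\<gamma>\<in>X. \<forall>x\<in>p'. g x = \<gamma>)"
  unfolding densely_constant_def dense_below_def by blast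

lemma nowhere_constant_below_null:
  assumes const_null: "\<And>\<gamma>. \<gamma> \<in> X \<Longrightarrow> {x\<in>p. g x = \<gamma>} \<in> I" and \<delta>_in_X: "\<delta> \<in> X"
  shows "{x\<in>p. (g x, \<delta>) \<in> \<kappa>} \<in> I"
proof (rule null_subset)
  show "(\<Union>\<gamma>\<in>under \<kappa> \<delta>. {x\<in>p. g x = \<gamma>}) \<in> I"
    using under_Field[of \<kappa> \<delta>] by (intro null_UN card_of_under_\<kappa>[OF \<delta>_in_X] const_null) blast
qed (auto simp: under_def)

lemma unbounded_over_mono:
  assumes "unbounded_over C z q" "q' \<subseteq> q"
  shows "unbounded_over C z q'"
  unfolding unbounded_over_def
proof
  fix \<gamma> assume "\<gamma> \<in> X"
  then have "{x\<in>q. \<forall>c\<in>C. (z x c, \<gamma>) \<in> \<kappa>} \<in> I" using assms(1) unfolding unbounded_over_def by blast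
  then show "{x\<in>q'. \<forall>c\<in>C. (z x c, \<gamma>) \<in> \<kappa>} \<in> I" by (rule null_subset) (use assms(2) in blast)
qed

lemma cofinal_sequence_mono: "cofinal_sequence C z q \<Longrightarrow> q' \<subseteq> q \<Longrightarrow> cofinal_sequence C z q'"
  using unbounded_over_mono dense_below_mono unfolding cofinal_sequence_def densely_constant_def
  by blast

lemma cofinal_sequence_exceeds:
  assumes "cofinal_sequence C z q" "b \<in> X"
  shows "{x\<in>q. \<forall>c\<in>C. (b, z x c) \<notin> \<kappa>} \<in> I"
proof (rule null_subset)
  show "{x\<in>q. \<forall>c\<in>C. (z x c, b) \<in> \<kappa>} \<in> I"
    using assms unfolding cofinal_sequence_def unbounded_over_def by blast
  have "z x c \<in> X" if "x \<in> q" "c \<in> C" for x c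
    using assms(1) that unfolding cofinal_sequence_def increasing_sequence_def by blast
  then show "{x\<in>q. \<forall>c\<in>C. (b, z x c) \<notin> \<kappa>} \<subseteq> {x\<in>q. \<forall>c\<in>C. (z x c, b) \<in> \<kappa>}"
    using Well_order_not_le_iff[OF Well_order_\<kappa> assms(2)] underS_imp_le[of _ \<kappa>] by blast
qed

lemma densely_constant_image_below:
  assumes g_constant: "densely_constant g q" and f_into_X: "f \<in> X \<rightarrow> X" and q_subset_X: "q \<subseteq> X"
  shows "{x\<in>q. f (g x) \<notin> underS \<kappa> x} \<in> I"
proof (rule ccontr)
  let ?N = "{x\<in>q. f (g x) \<notin> underS \<kappa> x}"
  assume "?N \<notin> I"
  then have "?N \<in> pos" using q_subset_X unfolding pos_iff by blast
  moreover have "?N \<subseteq> q" by blast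
  ultimately obtain p \<gamma> where p_pos: "p \<in> pos" and p_subset_N: "p \<subseteq> ?N" and \<gamma>_in_X: "\<gamma> \<in> X"
    and g_eq_\<gamma>: "\<And>x. x \<in> p \<Longrightarrow> g x = \<gamma>"
    using densely_constantD[OF g_constant] by meson
  have "f \<gamma> \<in> X" using f_into_X \<gamma>_in_X by blast
  then have "p \<subseteq> under \<kappa> (f \<gamma>)"
    using p_subset_N g_eq_\<gamma> q_subset_X Well_order_not_le_iff[OF Well_order_\<kappa>] unfolding under_def
    by blast
  then show False using null_subset[OF null_under[OF \<open>f \<gamma> \<in> X\<close>]] p_pos unfolding pos_iff by blast
qed

lemma cofinal_sequence_image_below:
  assumes "cofinal_sequence C z q" and f_into_X: "f \<in> X \<rightarrow> X" and q_subset_X: "q \<subseteq> X"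
  shows "{x\<in>q. \<exists>c\<in>C. f (z x c) \<notin> underS \<kappa> x} \<in> I"
proof -
  have "(\<Union>c\<in>C. {x\<in>q. f (z x c) \<notin> underS \<kappa> x}) \<in> I"
    using assms unfolding cofinal_sequence_def
    by (intro null_UN densely_constant_image_below) (auto intro: ordLess_imp_ordLeq)
  then show ?thesis by (rule null_subset) blast
qed

subsection \<open>Refinements along sequences of a different cofinality\<close>

text \<open>\<open>\<beta> \<in> D\<close> is determined by \<open>f \<beta> (\<zeta> d)\<close> for any \<open>d\<close> with \<open>h \<beta> \<le> \<zeta> d\<close>.\<close>

lemma card_of_conflicts:
  assumes x_in_X: "x \<in> X" and card_C: "|C| <o \<mu>" and \<xi>_in_Field: "\<xi> \<in> Field \<mu>"
    and h_disjointifies: "disjointifies \<kappa> f D h"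
    and D_witness:
      "\<And>\<beta>. \<beta> \<in> D \<Longrightarrow> \<exists>d\<in>C. (h \<beta>, \<zeta> d) \<in> \<kappa> \<and> f \<beta> (\<zeta> d) \<in> underS \<kappa> x \<and> idx x (f \<beta> (\<zeta> d)) \<in> underS \<mu> \<xi>"
  shows "|D| <o \<mu>"
proof -
  obtain d where d_in_C: "\<And>\<beta>. \<beta> \<in> D \<Longrightarrow> d \<beta> \<in> C" and h_le_d: "\<And>\<beta>. \<beta> \<in> D \<Longrightarrow> (h \<beta>, \<zeta> (d \<beta>)) \<in> \<kappa>"
    and f_less_x: "\<And>\<beta>. \<beta> \<in> D \<Longrightarrow> f \<beta> (\<zeta> (d \<beta>)) \<in> underS \<kappa> x"
    and idx_less_\<xi>: "\<And>\<beta>. \<beta> \<in> D \<Longrightarrow> idx x (f \<beta> (\<zeta> (d \<beta>))) \<in> underS \<mu> \<xi>"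
    using D_witness by metis
  let ?code = "\<lambda>\<beta>. (d \<beta>, idx x (f \<beta> (\<zeta> (d \<beta>))))"
  have "inj_on ?code D"
  proof (rule inj_onI, rule ccontr)
    fix \<beta> \<gamma> assume \<beta>_in_D: "\<beta> \<in> D" and \<gamma>_in_D: "\<gamma> \<in> D" and code_eq: "?code \<beta> = ?code \<gamma>"
      and \<beta>_neq_\<gamma>: "\<beta> \<noteq> \<gamma>"
    then have "f \<beta> (\<zeta> (d \<beta>)) = f \<gamma> (\<zeta> (d \<beta>))"
      using inj_on_idx[OF x_in_X] f_less_x[OF \<beta>_in_D] f_less_x[OF \<gamma>_in_D] unfolding inj_on_def
      by auto
    moreover have "(h \<gamma>, \<zeta> (d \<beta>)) \<in> \<kappa>" using h_le_d[OF \<gamma>_in_D] code_eq by simp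
    ultimately show False
      using h_disjointifies \<beta>_in_D \<gamma>_in_D code_eq \<beta>_neq_\<gamma> h_le_d[OF \<beta>_in_D]
      unfolding disjointifies_def by blast
  qed
  moreover have "?code ` D \<subseteq> C \<times> underS \<mu> \<xi>" using d_in_C h_le_d f_less_x idx_less_\<xi> by auto
  moreover have "|C \<times> underS \<mu> \<xi>| <o \<mu>"
    by (rule Times_Cinfinite_bound_strict[OF card_C card_of_underS[OF Card_order_\<mu> \<xi>_in_Field]
      Cinfinite_\<mu>])
  ultimately show ?thesis by (rule card_of_inj_ordLess)
qed

text \<open>
  Colour \<open>\<alpha>\<close> by a bound \<open>\<xi> \<alpha>\<close> of \<open>idx x (f \<alpha> (\<zeta> c))\<close> for cofinally many \<open>c\<close>. Only fewer than \<open>\<mu>\<close>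
  many \<open>\<beta>\<close> below \<open>\<alpha>\<close> with the same colour conflict with \<open>\<alpha>\<close>; a second colour separates \<open>\<alpha>\<close> from
  these.
\<close>

lemma colouring_along_sequence:
  assumes x_in_X: "x \<in> X" and \<zeta>_increasing: "increasing_sequence C \<zeta>" and card_C: "|C| <o \<mu>"
    and C_bounded: "cofinally_bounded \<mu> C"
    and h_disjointifies:
      "\<And>\<alpha>. \<alpha> \<in> Field (cardSuc \<kappa>) \<Longrightarrow> disjointifies \<kappa> f (underS (cardSuc \<kappa>) \<alpha>) (h \<alpha>)"
  shows "\<exists>E. (\<forall>\<alpha>\<in>Field (cardSuc \<kappa>). E \<alpha> \<in> Field \<mu> \<times> Field \<mu>) \<and>
    (\<forall>\<alpha>\<in>Field (cardSuc \<kappa>). \<forall>\<beta>\<in>underS (cardSuc \<kappa>) \<alpha>. E \<alpha> = E \<beta> \<longrightarrow>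
      (\<forall>c\<in>C. (h \<alpha> \<beta>, \<zeta> c) \<notin> \<kappa>) \<or> (\<exists>c\<in>C. f \<beta> (\<zeta> c) \<notin> underS \<kappa> x))"
proof -
  let ?U = "underS (cardSuc \<kappa>)"
  have "\<exists>\<xi>\<in>Field \<mu>. \<forall>c\<in>C. \<exists>d\<in>C. (c, d) \<in> \<mu> \<and> idx x (f \<alpha> (\<zeta> d)) \<in> underS \<mu> \<xi>" for \<alpha>
  proof -
    have "(\<lambda>d. idx x (f \<alpha> (\<zeta> d))) \<in> C \<rightarrow> Field \<mu>" using idx_Field[OF x_in_X] by blast
    then show ?thesis using C_bounded unfolding cofinally_bounded_def by (rule bspec[rotated])
  qed
  then obtain \<xi> where \<xi>_in_Field: "\<And>\<alpha>. \<xi> \<alpha> \<in> Field \<mu>"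
    and \<xi>_bounds: "\<And>\<alpha> c. c \<in> C \<Longrightarrow> \<exists>d\<in>C. (c, d) \<in> \<mu> \<and> idx x (f \<alpha> (\<zeta> d)) \<in> underS \<mu> (\<xi> \<alpha>)" by metis
  define D where "D \<alpha> = {\<beta>\<in>?U \<alpha>. \<xi> \<beta> = \<xi> \<alpha> \<and>
    (\<exists>c\<in>C. (h \<alpha> \<beta>, \<zeta> c) \<in> \<kappa>) \<and> (\<forall>c\<in>C. f \<beta> (\<zeta> c) \<in> underS \<kappa> x)}" for \<alpha>
  have "|D \<alpha>| <o \<mu>" if "\<alpha> \<in> Field (cardSuc \<kappa>)" for \<alpha>
  proof (rule card_of_conflicts[OF x_in_X card_C \<xi>_in_Field[of \<alpha>]])
    show "disjointifies \<kappa> f (D \<alpha>) (h \<alpha>)"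
      using h_disjointifies[OF that] unfolding disjointifies_def D_def by blast
    fix \<beta> assume \<beta>_in_D: "\<beta> \<in> D \<alpha>"
    then obtain c where c_in_C: "c \<in> C" and h_le_c: "(h \<alpha> \<beta>, \<zeta> c) \<in> \<kappa>" unfolding D_def by blast
    obtain d where d_in_C: "d \<in> C" and c_le_d: "(c, d) \<in> \<mu>"
      and idx_less_\<xi>: "idx x (f \<beta> (\<zeta> d)) \<in> underS \<mu> (\<xi> \<beta>)" using \<xi>_bounds[OF c_in_C] by blast
    have "(h \<alpha> \<beta>, \<zeta> d) \<in> \<kappa>"
      using Well_order_trans[OF Well_order_\<kappa> h_le_c] \<zeta>_increasing c_in_C d_in_C c_le_d
      unfolding increasing_sequence_def by blast
    then show "\<exists>d\<in>C. (h \<alpha> \<beta>, \<zeta> d) \<in> \<kappa> \<and> f \<beta> (\<zeta> d) \<in> underS \<kappa> x \<and> idx x (f \<beta> (\<zeta> d)) \<in> underS \<mu> (\<xi> \<alpha>)"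
      using d_in_C idx_less_\<xi> \<beta>_in_D unfolding D_def by auto
  qed
  then have "\<exists>\<epsilon>. \<forall>\<alpha>\<in>Field (cardSuc \<kappa>). \<epsilon> \<alpha> \<in> Field \<mu> \<and> \<epsilon> \<alpha> \<notin> \<epsilon> ` D \<alpha>"
    using Card_order_\<mu>
    by (intro Well_order_choice_avoiding[OF cardSuc_Well_order[OF Card_order_\<kappa>]])
      (auto simp: ordLess_card_of_Field_iff D_def)
  then obtain \<epsilon> where \<epsilon>_avoids: "\<And>\<alpha>. \<alpha> \<in> Field (cardSuc \<kappa>) \<Longrightarrow> \<epsilon> \<alpha> \<in> Field \<mu> \<and> \<epsilon> \<alpha> \<notin> \<epsilon> ` D \<alpha>" by blast
  have "(\<forall>c\<in>C. (h \<alpha> \<beta>, \<zeta> c) \<notin> \<kappa>) \<or> (\<exists>c\<in>C. f \<beta> (\<zeta> c) \<notin> underS \<kappa> x)"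
    if "\<alpha> \<in> Field (cardSuc \<kappa>)" "\<beta> \<in> ?U \<alpha>" "(\<xi> \<alpha>, \<epsilon> \<alpha>) = (\<xi> \<beta>, \<epsilon> \<beta>)" for \<alpha> \<beta>
    using \<epsilon>_avoids[OF that(1)] that(2,3) unfolding D_def by auto
  then show ?thesis using \<xi>_in_Field \<epsilon>_avoids by (intro exI[of _ "\<lambda>\<alpha>. (\<xi> \<alpha>, \<epsilon> \<alpha>)"]) auto
qed

lemma separating_matrix:
  assumes card_C: "|C| <o \<mu>" and C_bounded: "cofinally_bounded \<mu> C"
  shows "\<exists>E. (\<forall>x\<in>X. \<forall>\<alpha>\<in>Field (cardSuc \<kappa>). E x \<alpha> \<in> Field \<mu> \<times> Field \<mu>) \<and>
    (\<forall>q\<subseteq>X. cofinal_sequence C z q \<longrightarrow>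
      pairwise (\<lambda>\<alpha> \<beta>. {x\<in>q. E x \<alpha> = E x \<beta>} \<in> I) (Field (cardSuc \<kappa>)))"
proof -
  let ?\<Lambda> = "Field (cardSuc \<kappa>)" and ?U = "underS (cardSuc \<kappa>)"
  have Well_order_succ_\<kappa>: "Well_order (cardSuc \<kappa>)" by (rule cardSuc_Well_order[OF Card_order_\<kappa>])
  obtain f where f_in_X: "\<And>\<alpha> y. \<alpha> \<in> ?\<Lambda> \<Longrightarrow> f \<alpha> y \<in> X"
    and diff: "pairwise (\<lambda>\<alpha> \<beta>. eventually_different \<kappa> (f \<alpha>) (f \<beta>)) ?\<Lambda>"
    using eventually_different_family[OF Cinfinite_\<kappa>] by blast
  have "\<exists>h. disjointifies \<kappa> f (?U \<alpha>) h" if "\<alpha> \<in> ?\<Lambda>" for \<alpha>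
    using card_of_underS_cardSuc[OF Card_order_\<kappa> that]
      pairwise_subset[OF diff Order_Relation.underS_Field]
    by (rule disjointifies_exists[OF Cinfinite_\<kappa> regularCard_\<kappa>])
  then obtain h where h_disjointifies: "\<And>\<alpha>. \<alpha> \<in> ?\<Lambda> \<Longrightarrow> disjointifies \<kappa> f (?U \<alpha>) (h \<alpha>)" by metis
  have "\<exists>E. (\<forall>\<alpha>\<in>?\<Lambda>. E \<alpha> \<in> Field \<mu> \<times> Field \<mu>) \<and> (increasing_sequence C (z x) \<longrightarrow>
      (\<forall>\<alpha>\<in>?\<Lambda>. \<forall>\<beta>\<in>?U \<alpha>. E \<alpha> = E \<beta> \<longrightarrow>
        (\<forall>c\<in>C. (h \<alpha> \<beta>, z x c) \<notin> \<kappa>) \<or> (\<exists>c\<in>C. f \<beta> (z x c) \<notin> underS \<kappa> x)))" if x_in_X: "x \<in> X" for x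
  proof (cases "increasing_sequence C (z x)")
    case True
    then show ?thesis
      using colouring_along_sequence[OF x_in_X True card_C C_bounded h_disjointifies] by blast
  next
    case False
    then show ?thesis using idx_Field[OF x_in_X] by (intro exI[of _ "\<lambda>_. (idx x x, idx x x)"]) blast
  qed
  then obtain E where E_in_Field: "\<And>x \<alpha>. x \<in> X \<Longrightarrow> \<alpha> \<in> ?\<Lambda> \<Longrightarrow> E x \<alpha> \<in> Field \<mu> \<times> Field \<mu>"
    and E_separates:
      "\<And>x \<alpha> \<beta>. x \<in> X \<Longrightarrow> increasing_sequence C (z x) \<Longrightarrow> \<alpha> \<in> ?\<Lambda> \<Longrightarrow> \<beta> \<in> ?U \<alpha> \<Longrightarrow> E x \<alpha> = E x \<beta> \<Longrightarrow>
      (\<forall>c\<in>C. (h \<alpha> \<beta>, z x c) \<notin> \<kappa>) \<or> (\<exists>c\<in>C. f \<beta> (z x c) \<notin> underS \<kappa> x)" by metis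
  have "{x\<in>q. E x \<alpha> = E x \<beta>} \<in> I"
    if q_subset_X: "q \<subseteq> X" and sequence: "cofinal_sequence C z q" and \<beta>_less_\<alpha>: "\<beta> \<in> ?U \<alpha>" for q \<alpha> \<beta>
  proof (rule null_subset)
    have \<alpha>_in_\<Lambda>: "\<alpha> \<in> ?\<Lambda>" and "\<beta> \<in> ?\<Lambda>" using underS_imp_Field[OF \<beta>_less_\<alpha>] by blast+
    then show "{x\<in>q. \<forall>c\<in>C. (h \<alpha> \<beta>, z x c) \<notin> \<kappa>} \<union> {x\<in>q. \<exists>c\<in>C. f \<beta> (z x c) \<notin> underS \<kappa> x} \<in> I"
      using h_disjointifies[OF \<alpha>_in_\<Lambda>] \<beta>_less_\<alpha> f_in_X q_subset_X sequence
      unfolding disjointifies_def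
      by (intro null_Un cofinal_sequence_exceeds cofinal_sequence_image_below) auto
    show "{x\<in>q. E x \<alpha> = E x \<beta>} \<subseteq>
        {x\<in>q. \<forall>c\<in>C. (h \<alpha> \<beta>, z x c) \<notin> \<kappa>} \<union> {x\<in>q. \<exists>c\<in>C. f \<beta> (z x c) \<notin> underS \<kappa> x}"
      using E_separates[OF _ _ \<alpha>_in_\<Lambda> \<beta>_less_\<alpha>] q_subset_X sequence unfolding cofinal_sequence_def
      by blast
  qed
  then have "pairwise (\<lambda>\<alpha> \<beta>. {x\<in>q. E x \<alpha> = E x \<beta>} \<in> I) ?\<Lambda>" if "q \<subseteq> X" "cofinal_sequence C z q" for q
    using that by (intro pairwise_Field[OF Well_order_succ_\<kappa>]) (auto elim: null_subset)
  then show ?thesis using E_in_Field by (intro exI[of _ E]) blast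
qed

lemma cofinal_sequence_refinement:
  assumes card_J: "|J| \<le>o \<kappa>" and A_pos: "\<And>i. i \<in> J \<Longrightarrow> A i \<in> pos"
    and sequence: "\<And>i. i \<in> J \<Longrightarrow> cofinal_sequence C z (A i)" and bounded: "cofinally_bounded \<mu> C"
  shows "\<exists>B. pos_refinement J B A \<and> pairwise (\<lambda>i j. B i \<inter> B j \<in> I) J"
proof (cases "J = {}")
  case True
  then show ?thesis unfolding pos_refinement_def pairwise_def by blast
next
  case False
  then have "|C| <o \<mu>" using sequence unfolding cofinal_sequence_def by blast
  then obtain E where E_in_Field: "\<And>x \<alpha>. x \<in> X \<Longrightarrow> \<alpha> \<in> Field (cardSuc \<kappa>) \<Longrightarrow> E x \<alpha> \<in> Field \<mu> \<times> Field \<mu>"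
    and E_separates: "\<And>q. q \<subseteq> X \<Longrightarrow> cofinal_sequence C z q \<Longrightarrow>
      pairwise (\<lambda>\<alpha> \<beta>. {x\<in>q. E x \<alpha> = E x \<beta>} \<in> I) (Field (cardSuc \<kappa>))"
    using separating_matrix[OF _ bounded, of z] by blast
  have "|Field \<mu> \<times> Field \<mu>| \<le>o \<mu>"
    by (intro card_of_Times_ordLeq_infinite_Field infinite_\<mu> Card_order_\<mu> card_of_Field_ordLeq)
  then show ?thesis
  proof (rule matrix_refinement[OF Cinfinite_\<kappa> \<mu>_ordLeq_\<kappa> card_J])
    show "\<not> |Field (cardSuc \<kappa>)| \<le>o \<kappa>" by (rule not_card_of_Field_cardSuc_ordLeq[OF Card_order_\<kappa>])
    show "pairwise (\<lambda>\<alpha> \<beta>. {x\<in>A i. E x \<alpha> = E x \<beta>} \<in> I) (Field (cardSuc \<kappa>))" if "i \<in> J" for i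
      using E_separates A_pos sequence that unfolding pos_iff by blast
  qed (use E_in_Field A_pos in blast)+
qed

subsection \<open>Essentially bounded sets of ordinals\<close>

text \<open>
  Below \<open>q\<close>, the set of ordinals represented by \<open>a\<close> has no element strictly between \<open>\<gamma>\<close> and \<open>\<kappa>\<close>; it
  may well have elements above \<open>\<kappa>\<close>, since the ideal need not be normal.
\<close>

definition bounded_by :: "('k \<Rightarrow> 'k set) \<Rightarrow> 'k \<Rightarrow> 'k set \<Rightarrow> bool" where
  "bounded_by a \<gamma> q \<longleftrightarrow> (\<forall>\<delta>. \<gamma> \<in> underS \<kappa> \<delta> \<longrightarrow> {x\<in>q. \<delta> \<in> a x} \<in> I)"

definition nowhere_bounded :: "('k \<Rightarrow> 'k set) \<Rightarrow> 'k set \<Rightarrow> bool" where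
  "nowhere_bounded a q \<longleftrightarrow> \<not> (\<exists>p\<subseteq>q. p \<in> pos \<and> (\<exists>\<gamma>\<in>X. bounded_by a \<gamma> p))"

lemma bounded_byI:
  assumes "\<And>x \<delta>. x \<in> q \<Longrightarrow> \<delta> \<in> a x \<Longrightarrow> \<gamma> \<notin> underS \<kappa> \<delta>"
  shows "bounded_by a \<gamma> q"
  unfolding bounded_by_def
proof (intro allI impI)
  fix \<delta> assume "\<gamma> \<in> underS \<kappa> \<delta>"
  then have "{x\<in>q. \<delta> \<in> a x} = {}" using assms by blast
  then show "{x\<in>q. \<delta> \<in> a x} \<in> I" using null_empty by (simp only:)
qed

lemma bounded_by_mono:
  assumes "bounded_by a \<gamma> q" "q' \<subseteq> q"
  shows "bounded_by a \<gamma> q'"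
  unfolding bounded_by_def
proof (intro allI impI)
  fix \<delta> assume "\<gamma> \<in> underS \<kappa> \<delta>"
  then have "{x\<in>q. \<delta> \<in> a x} \<in> I" using assms(1) unfolding bounded_by_def by blast
  then show "{x\<in>q'. \<delta> \<in> a x} \<in> I" by (rule null_subset) (use assms(2) in blast)
qed

lemma bounded_by_overlap:
  assumes q_bounded: "bounded_by a \<gamma> q" and "p \<inter> q \<notin> I" "\<And>x. x \<in> p \<Longrightarrow> \<delta> \<in> a x" and "\<gamma> \<in> X" "\<delta> \<in> X"
  shows "(\<delta>, \<gamma>) \<in> \<kappa>"
proof (rule ccontr)
  assume "(\<delta>, \<gamma>) \<notin> \<kappa>"
  then have "{x\<in>q. \<delta> \<in> a x} \<in> I"
    using q_bounded Well_order_not_le_iff[OF Well_order_\<kappa> assms(5,4)] unfolding bounded_by_def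
    by blast
  then have "p \<inter> q \<in> I" by (rule null_subset) (use assms(3) in blast)
  then show False using assms(2) by blast
qed

lemma nowhere_boundedD:
  "nowhere_bounded a q \<Longrightarrow> p \<subseteq> q \<Longrightarrow> p \<in> pos \<Longrightarrow> \<gamma> \<in> X \<Longrightarrow> \<not> bounded_by a \<gamma> p"
  unfolding nowhere_bounded_def by blast

lemma not_dense_below_bounded:
  assumes "\<not> dense_below (\<lambda>p. \<exists>\<gamma>\<in>X. bounded_by a \<gamma> p) A"
  shows "\<exists>q\<subseteq>A. q \<in> pos \<and> nowhere_bounded a q"
  using assms unfolding dense_below_def nowhere_bounded_def by simp

definition enumerates :: "'a set \<Rightarrow> ('k \<Rightarrow> 'a \<Rightarrow> 'k) \<Rightarrow> ('k \<Rightarrow> 'k set) \<Rightarrow> 'k set \<Rightarrow> bool" where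
  "enumerates C z a p \<longleftrightarrow> (\<forall>x\<in>p. bij_betw (z x) C (a x) \<and> increasing_sequence C (z x))"

lemma enumerates_image: "enumerates C z a p \<Longrightarrow> x \<in> p \<Longrightarrow> a x = z x ` C"
  unfolding enumerates_def bij_betw_def by simp

lemma uniform_enumeration:
  assumes q_pos: "q \<in> pos" and a_small: "\<And>x. x \<in> q \<Longrightarrow> a x \<subseteq> X \<and> |a x| <o \<mu>"
  shows "\<exists>\<tau>\<in>Field \<mu>. \<exists>z. \<exists>p\<subseteq>q. p \<in> pos \<and> enumerates (underS \<mu> \<tau>) z a p"
proof -
  have "\<exists>\<tau>\<in>Field \<mu>. \<exists>f. bij_betw f (underS \<mu> \<tau>) (a x) \<and> increasing_sequence (underS \<mu> \<tau>) f"
    if x_in_q: "x \<in> q" for x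
  proof -
    have "\<exists>\<tau>\<in>Field \<mu>. \<exists>f. bij_betw f (underS \<mu> \<tau>) (a x) \<and>
      (\<forall>c\<in>underS \<mu> \<tau>. \<forall>d\<in>underS \<mu> \<tau>. (c, d) \<in> \<mu> \<longrightarrow> (f c, f d) \<in> \<kappa>)"
      using a_small[OF x_in_q] by (intro increasing_enumeration Card_order_\<mu> Well_order_\<kappa>) auto
    moreover have "f \<in> underS \<mu> \<tau> \<rightarrow> X" if "bij_betw f (underS \<mu> \<tau>) (a x)" for f \<tau>
      using a_small[OF x_in_q] that unfolding bij_betw_def by blast
    ultimately show ?thesis unfolding increasing_sequence_def by meson
  qed
  then obtain \<tau> z where \<tau>_in_Field: "\<And>x. x \<in> q \<Longrightarrow> \<tau> x \<in> Field \<mu>"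
    and z_bij: "\<And>x. x \<in> q \<Longrightarrow> bij_betw (z x) (underS \<mu> (\<tau> x)) (a x)"
    and z_increasing: "\<And>x. x \<in> q \<Longrightarrow> increasing_sequence (underS \<mu> (\<tau> x)) (z x)" by metis
  have "\<exists>t\<in>Field \<mu>. {x\<in>q. \<tau> x = t} \<in> pos"
    using \<tau>_in_Field by (intro pos_pigeonhole[OF q_pos card_of_Field_ordLeq[OF Card_order_\<mu>]]) blast
  then obtain t where t_in_Field: "t \<in> Field \<mu>" and t_pos: "{x\<in>q. \<tau> x = t} \<in> pos" by blast
  have "enumerates (underS \<mu> t) z a {x\<in>q. \<tau> x = t}"
    using z_bij z_increasing unfolding enumerates_def by blast
  moreover have "{x\<in>q. \<tau> x = t} \<subseteq> q" by blast
  ultimately show ?thesis using t_in_Field t_pos by blast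
qed

lemma nowhere_bounded_imp_unbounded_over:
  assumes enum: "enumerates C z a p" and p_pos: "p \<in> pos" and nowhere_bounded: "nowhere_bounded a p"
  shows "unbounded_over C z p"
  unfolding unbounded_over_def
proof (intro ballI, rule ccontr)
  fix \<gamma> assume \<gamma>_in_X: "\<gamma> \<in> X"
  let ?S = "{x\<in>p. \<forall>c\<in>C. (z x c, \<gamma>) \<in> \<kappa>}"
  assume "?S \<notin> I"
  then have "?S \<in> pos" using p_pos unfolding pos_iff by blast
  have "bounded_by a \<gamma> ?S"
  proof (rule bounded_byI)
    fix x \<delta> assume x_in_S: "x \<in> ?S" and "\<delta> \<in> a x"
    then obtain c where "c \<in> C" "\<delta> = z x c" using enumerates_image[OF enum, of x] by blast
    then have "(\<delta>, \<gamma>) \<in> \<kappa>" using x_in_S by blast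
    then show "\<gamma> \<notin> underS \<kappa> \<delta>"
      using Well_order_not_le_iff[OF Well_order_\<kappa>] underS_imp_Field[of \<gamma> \<kappa> \<delta>] by blast
  qed
  then show False using nowhere_boundedD[OF nowhere_bounded _ \<open>?S \<in> pos\<close> \<gamma>_in_X] by blast
qed

text \<open>
  If \<open>z x c\<close> were nowhere constant, it would be almost everywhere above every \<open>\<delta>\<close>, and so the bound
  on an initial segment given by minimality would be a bound of \<open>a\<close>.
\<close>

lemma minimal_unbounded_densely_constant:
  assumes enum: "enumerates (underS \<mu> \<tau>) z a q" and nowhere_bounded: "nowhere_bounded a q"
    and c_less_\<tau>: "c \<in> underS \<mu> \<tau>"
    and minimal: "\<And>p. p \<subseteq> q \<Longrightarrow> p \<in> pos \<Longrightarrow> \<not> unbounded_over (underS \<mu> c) z p"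
  shows "densely_constant (\<lambda>x. z x c) q"
  unfolding densely_constant_def dense_below_def
proof (intro allI impI, rule ccontr)
  fix p assume p_subset_q: "p \<subseteq> q" and p_pos: "p \<in> pos"
    and not_const: "\<not> (\<exists>p'\<subseteq>p. p' \<in> pos \<and> (\<exists>\<gamma>\<in>X. \<forall>x\<in>p'. z x c = \<gamma>))"
  have const_null: "{x\<in>p. z x c = \<gamma>} \<in> I" if "\<gamma> \<in> X" for \<gamma>
  proof (rule ccontr)
    assume "{x\<in>p. z x c = \<gamma>} \<notin> I"
    then have "{x\<in>p. z x c = \<gamma>} \<in> pos" using p_pos unfolding pos_iff by blast
    then have "\<exists>p'\<subseteq>p. p' \<in> pos \<and> (\<exists>\<gamma>\<in>X. \<forall>x\<in>p'. z x c = \<gamma>)"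
      using that by (intro exI[of _ "{x\<in>p. z x c = \<gamma>}"] conjI bexI[of _ \<gamma>]) auto
    with not_const show False by contradiction
  qed
  obtain \<gamma> where \<gamma>_in_X: "\<gamma> \<in> X"
    and S_not_null: "{x\<in>p. \<forall>d\<in>underS \<mu> c. (z x d, \<gamma>) \<in> \<kappa>} \<notin> I" (is "?S \<notin> I")
    using minimal[OF p_subset_q p_pos] unfolding unbounded_over_def by blast
  have "bounded_by a \<gamma> ?S" unfolding bounded_by_def
  proof (intro allI impI)
    fix \<delta> assume \<gamma>_less_\<delta>: "\<gamma> \<in> underS \<kappa> \<delta>"
    have "(z x c, \<delta>) \<in> \<kappa>" if x_in_S: "x \<in> ?S" and \<delta>_in_a: "\<delta> \<in> a x" for x
    proof -
      have x_in_q: "x \<in> q" using x_in_S p_subset_q by blast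
      then obtain b where b_less_\<tau>: "b \<in> underS \<mu> \<tau>" and \<delta>_eq_b: "\<delta> = z x b"
        using \<delta>_in_a enumerates_image[OF enum] by blast
      have "b \<notin> underS \<mu> c"
        using x_in_S \<delta>_eq_b \<gamma>_less_\<delta> Well_order_not_le_iff[OF Well_order_\<kappa>]
          underS_imp_Field[OF \<gamma>_less_\<delta>] by blast
      then have "(c, b) \<in> \<mu>"
        using Well_order_not_le_iff[OF Well_order_\<mu>] underS_imp_Field[OF c_less_\<tau>]
          underS_imp_Field[OF b_less_\<tau>] by blast
      then show ?thesis
        using enum x_in_q b_less_\<tau> \<delta>_eq_b c_less_\<tau> unfolding enumerates_def increasing_sequence_def
        by blast
    qed
    then have "{x\<in>?S. \<delta> \<in> a x} \<subseteq> {x\<in>p. (z x c, \<delta>) \<in> \<kappa>}" by blast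
    then show "{x\<in>?S. \<delta> \<in> a x} \<in> I"
      using null_subset[OF nowhere_constant_below_null[OF const_null]]
        underS_imp_Field[OF \<gamma>_less_\<delta>] by blast
  qed
  moreover have "?S \<in> pos" "?S \<subseteq> q" using S_not_null p_subset_q p_pos unfolding pos_iff by blast+
  ultimately show False using nowhere_boundedD[OF nowhere_bounded _ _ \<gamma>_in_X] by blast
qed

lemma nowhere_bounded_cofinal_sequence:
  assumes q_pos: "q \<in> pos" and a_small: "\<And>x. x \<in> q \<Longrightarrow> a x \<subseteq> X \<and> |a x| <o \<mu>"
    and nowhere_bounded: "nowhere_bounded a q"
  shows "\<exists>C z p. p \<subseteq> q \<and> p \<in> pos \<and> cofinal_sequence C z p \<and> (\<exists>x\<in>q. |C| \<le>o |a x| )"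
proof -
  obtain \<tau> z p where \<tau>_in_Field: "\<tau> \<in> Field \<mu>" and p_subset_q: "p \<subseteq> q" and p_pos: "p \<in> pos"
    and enum: "enumerates (underS \<mu> \<tau>) z a p"
    using uniform_enumeration[OF q_pos, of a] a_small by blast
  have nb_sub: "nowhere_bounded a p'" if "p' \<subseteq> p" for p'
    using nowhere_bounded that p_subset_q unfolding nowhere_bounded_def by blast
  define M where "M = {m. (m, \<tau>) \<in> \<mu> \<and> (\<exists>r\<subseteq>p. r \<in> pos \<and> unbounded_over (underS \<mu> m) z r)}"
  have "\<tau> \<in> M"
    using nowhere_bounded_imp_unbounded_over[OF enum p_pos nb_sub] p_pos
      Well_order_refl[OF Well_order_\<mu> \<tau>_in_Field]
    unfolding M_def by blast
  moreover have "M \<subseteq> Field \<mu>" unfolding M_def Field_def by blast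
  ultimately obtain m where m_in_M: "m \<in> M" and least: "\<And>n. n \<in> M \<Longrightarrow> (m, n) \<in> \<mu>"
    using Well_order_least[OF Well_order_\<mu>, of M] by blast
  obtain r where r_subset_p: "r \<subseteq> p" and r_pos: "r \<in> pos"
    and r_unbounded: "unbounded_over (underS \<mu> m) z r" and m_le_\<tau>: "(m, \<tau>) \<in> \<mu>"
    using m_in_M unfolding M_def by blast
  let ?C = "underS \<mu> m"
  have C_subset: "?C \<subseteq> underS \<mu> \<tau>" using underS_le_trans[OF Well_order_\<mu> _ m_le_\<tau>] by blast
  have "densely_constant (\<lambda>x. z x c) r" if c_in_C: "c \<in> ?C" for c
  proof (rule minimal_unbounded_densely_constant)
    show "enumerates (underS \<mu> \<tau>) z a r" using enum r_subset_p unfolding enumerates_def by blast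
    have "c \<notin> M"
      using least c_in_C Well_order_not_le_iff[OF Well_order_\<mu>] underS_imp_Field[OF c_in_C] by blast
    then show "\<not> unbounded_over (underS \<mu> c) z r'" if "r' \<subseteq> r" "r' \<in> pos" for r'
      using that r_subset_p C_subset c_in_C underS_imp_le[of c \<mu>] unfolding M_def by blast
  qed (use nb_sub r_subset_p C_subset c_in_C in blast)+
  moreover have "increasing_sequence ?C (z x)" if "x \<in> r" for x
    using enum that r_subset_p C_subset unfolding enumerates_def increasing_sequence_def by blast
  moreover have "|?C| <o \<mu>"
    using m_le_\<tau> by (intro card_of_underS Card_order_\<mu>) (auto simp: Field_def)
  ultimately have "cofinal_sequence ?C z r"
    using r_unbounded unfolding cofinal_sequence_def by (simp add: Order_Relation.underS_Field)
  moreover obtain x where x_in_r: "x \<in> r" using pos_nonempty[OF r_pos] by blast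
  moreover have "|?C| \<le>o |a x|"
  proof (intro card_of_ordLeqI)
    have "bij_betw (z x) (underS \<mu> \<tau>) (a x)"
      using enum r_subset_p x_in_r unfolding enumerates_def by blast
    then show "inj_on (z x) ?C" "\<And>c. c \<in> ?C \<Longrightarrow> z x c \<in> a x"
      using C_subset unfolding bij_betw_def by (auto intro: inj_on_subset)
  qed
  ultimately show ?thesis using r_subset_p r_pos r_unbounded p_subset_q x_in_r by blast
qed

subsection \<open>Disposing of the sequences of a different cofinality\<close>

definition has_cofinal_sequence :: "'k set \<Rightarrow> bool" where
  "has_cofinal_sequence q \<longleftrightarrow> (\<exists>C z. cofinal_sequence C z q \<and> cofinally_bounded \<mu> C)"

lemma has_cofinal_sequence_mono: "has_cofinal_sequence q \<Longrightarrow> q' \<subseteq> q \<Longrightarrow> has_cofinal_sequence q'"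
  using cofinal_sequence_mono unfolding has_cofinal_sequence_def by blast

lemma has_cofinal_sequence_refinement:
  assumes card_J: "|J| \<le>o \<kappa>" and A_sequence: "\<And>i. i \<in> J \<Longrightarrow> A i \<in> pos \<and> has_cofinal_sequence (A i)"
  shows "\<exists>B. pos_refinement J B A \<and> pairwise (\<lambda>i j. B i \<inter> B j \<in> I) J"
proof -
  define P where "P s q \<longleftrightarrow> cofinal_sequence (fst s) (snd s) q \<and> cofinally_bounded \<mu> (fst s)" for s q
  have "P s q'" if "P s q" "q' \<subseteq> q" for s q q'
    using that cofinal_sequence_mono unfolding P_def by blast
  moreover have "\<exists>s. \<exists>q\<subseteq>A i. q \<in> pos \<and> P s q" if "i \<in> J" for i
    using A_sequence[OF that] unfolding has_cofinal_sequence_def P_def by auto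
  ultimately obtain q t where q_refines_A: "pos_refinement J q A" and q_kind: "\<forall>i\<in>J. P (t i) (q i)"
    and null: "pairwise (\<lambda>i j. t i \<noteq> t j \<longrightarrow> q i \<inter> q j \<in> I) J"
    using refinement_by_kinds[of P J A] by blast
  define K where "K s = {i\<in>J. t i = s}" for s
  have "\<exists>B. pos_refinement (K s) B q \<and> pairwise (\<lambda>i j. B i \<inter> B j \<in> I) (K s)" for s
  proof (cases "K s = {}")
    case False
    have "|K s| \<le>o \<kappa>" by (rule card_of_subset_ordLeq[OF _ card_J]) (auto simp: K_def)
    moreover have "q i \<in> pos" "P s (q i)" if "i \<in> K s" for i
      using that q_refines_A q_kind unfolding K_def pos_refinement_def by blast+
    ultimately show ?thesis
      using False cofinal_sequence_refinement[of "K s" q "fst s" "snd s"] unfolding P_def by blast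
  qed (simp add: pos_refinement_def)
  then obtain D where D_refines_q: "\<And>s. pos_refinement (K s) (D s) q"
    and D_almost_disjoint: "\<And>s. pairwise (\<lambda>i j. D s i \<inter> D s j \<in> I) (K s)" by metis
  let ?B = "\<lambda>i. D (t i) i"
  have B_refines_q: "pos_refinement J ?B q"
    using D_refines_q unfolding pos_refinement_def K_def by blast
  have "?B i \<inter> ?B j \<in> I" if i_in_J: "i \<in> J" and j_in_J: "j \<in> J" and i_neq_j: "i \<noteq> j" for i j
  proof (cases "t i = t j")
    case True
    then show ?thesis
      using D_almost_disjoint[of "t i"] i_in_J j_in_J i_neq_j unfolding pairwise_def K_def by auto
  next
    case False
    then have "q i \<inter> q j \<in> I" using null i_in_J j_in_J i_neq_j unfolding pairwise_def by blast
    then show ?thesis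
      by (rule null_subset)
        (use B_refines_q i_in_J j_in_J i_neq_j in \<open>auto simp: pos_refinement_def\<close>)
  qed
  then show ?thesis
    using pos_refinement_trans[OF B_refines_q q_refines_A] unfolding pairwise_def
    by (intro exI[of _ ?B]) blast
qed

lemma refinement_by_kinds_modulo_cofinal_sequences:
  assumes card_J: "|J| \<le>o \<kappa>" and hereditary: "\<And>k q q'. P k q \<Longrightarrow> q' \<subseteq> q \<Longrightarrow> P k q'"
    and dense: "\<And>i. i \<in> J \<Longrightarrow> \<exists>q\<subseteq>A i. q \<in> pos \<and> (has_cofinal_sequence q \<or> (\<exists>k. P k q))"
  shows "\<exists>B k. pos_refinement J B A \<and>
    pairwise (\<lambda>i j. B i \<inter> B j \<in> I \<or> k i = k j \<and> P (k i) (B i) \<and> P (k j) (B j)) J"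
proof -
  define S where "S = {i\<in>J. \<exists>q\<subseteq>A i. q \<in> pos \<and> has_cofinal_sequence q}"
  have "\<exists>p. \<forall>i\<in>S. p i \<subseteq> A i \<and> p i \<in> pos \<and> has_cofinal_sequence (p i)"
    unfolding S_def by (intro bchoice) blast
  then obtain p where p_refines_A: "pos_refinement S p A"
    and p_sequence: "\<And>i. i \<in> S \<Longrightarrow> has_cofinal_sequence (p i)"
    unfolding pos_refinement_def by blast
  have "|S| \<le>o \<kappa>" by (rule card_of_subset_ordLeq[OF _ card_J]) (auto simp: S_def)
  then obtain D where D_refines_p: "pos_refinement S D p"
    and D_almost_disjoint: "pairwise (\<lambda>i j. D i \<inter> D j \<in> I) S"
    using has_cofinal_sequence_refinement[of S p] p_refines_A p_sequence
    unfolding pos_refinement_def by blast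
  have "\<exists>k. \<exists>q\<subseteq>A i. q \<in> pos \<and> P k q" if "i \<in> J - S" for i
    using dense[of i] that unfolding S_def by blast
  then obtain q k where q_refines_A: "pos_refinement (J - S) q A"
    and q_kind: "\<forall>i\<in>J - S. P (k i) (q i)"
    and kinds: "pairwise (\<lambda>i j. k i \<noteq> k j \<longrightarrow> q i \<inter> q j \<in> I) (J - S)"
    using refinement_by_kinds[of P "J - S" A] hereditary by blast
  have mixed: "D i \<inter> q j \<in> I" if "i \<in> S" "j \<in> J - S" for i j
  proof (rule ccontr)
    assume "D i \<inter> q j \<notin> I"
    then have "D i \<inter> q j \<in> pos"
      using D_refines_p that(1) unfolding pos_refinement_def pos_iff by blast
    moreover have "has_cofinal_sequence (D i \<inter> q j)"
      by (rule has_cofinal_sequence_mono[OF p_sequence[OF that(1)]])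
        (use D_refines_p that(1) in \<open>auto simp: pos_refinement_def\<close>)
    moreover have "D i \<inter> q j \<subseteq> A j" using q_refines_A that(2) unfolding pos_refinement_def by blast
    ultimately show False using that(2) unfolding S_def by blast
  qed
  define B where "B i = (if i \<in> S then D i else q i)" for i
  have "pos_refinement J B A"
    using pos_refinement_trans[OF D_refines_p p_refines_A] q_refines_A
    unfolding pos_refinement_def B_def by auto
  moreover have "B i \<inter> B j \<in> I \<or> k i = k j \<and> P (k i) (B i) \<and> P (k j) (B j)"
    if "i \<in> J" "j \<in> J" "i \<noteq> j" for i j
    using that D_almost_disjoint kinds q_kind mixed[of i j] mixed[of j i]
    unfolding B_def pairwise_def by (auto simp: Int_commute)
  ultimately show ?thesis unfolding pairwise_def by blast
qed

end

section \<open>Refinements ranked by the cofinality of \<open>\<mu>\<close>\<close>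

lemma cofinal_map_of_not_cofinally_bounded:
  assumes Cinfinite_r: "Cinfinite r" and C_subset: "C \<subseteq> Field r"
    and not_bounded: "\<not> cofinally_bounded r C"
  shows "\<exists>t\<in>Field (cf r) \<rightarrow> C. \<forall>c\<in>C. \<exists>k\<in>Field (cf r). (c, t k) \<in> r"
proof -
  have Well_order_r: "Well_order r" using Cinfinite_r card_order_on_well_order_on by blast
  obtain s where s_into_Field: "s \<in> C \<rightarrow> Field r"
    and "\<forall>\<xi>\<in>Field r. \<exists>c\<in>C. \<forall>d\<in>C. (c, d) \<in> r \<longrightarrow> s d \<notin> underS r \<xi>"
    using not_bounded unfolding cofinally_bounded_def by blast
  then obtain t where t_in_C: "\<And>\<xi>. \<xi> \<in> Field r \<Longrightarrow> t \<xi> \<in> C"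
    and t_unbounded: "\<And>\<xi> d. \<xi> \<in> Field r \<Longrightarrow> d \<in> C \<Longrightarrow> (t \<xi>, d) \<in> r \<Longrightarrow> s d \<notin> underS r \<xi>" by metis
  have "\<exists>k\<in>Field (cf r). (c, t k) \<in> r" if c_in_C: "c \<in> C" for c
  proof -
    obtain k where k_in_cf: "k \<in> Field (cf r)" and s_less_k: "s c \<in> underS r k"
      using cf_exceeds[OF Cinfinite_r, of "s c"] s_into_Field c_in_C by blast
    then have "k \<in> Field r" using Field_cf_subset[OF Cinfinite_r] by blast
    then have "(t k, c) \<notin> r" "t k \<in> Field r"
      using t_in_C t_unbounded s_less_k c_in_C C_subset by blast+
    then have "(c, t k) \<in> r"
      using Well_order_not_le_iff[OF Well_order_r, of "t k" c] underS_imp_le[of c] c_in_C C_subset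
      by blast
    then show ?thesis using k_in_cf by blast
  qed
  then show ?thesis using t_in_C Field_cf_subset[OF Cinfinite_r] by (intro bexI[of _ t]) auto
qed

context ideal_on_succ_cardinal
begin

lemmas Field_cf_\<mu> = Field_cf_subset[OF Cinfinite_\<mu>]
  and Card_order_cf_\<mu> = Card_order_cf[OF Cinfinite_\<mu>]
  and Well_order_cf_\<mu> = Well_order_cf[OF Cinfinite_\<mu>]

lemma card_of_Field_cf_\<mu>: "|Field (cf \<mu>)| \<le>o \<mu>"
  by (rule card_of_subset_ordLeq[OF Field_cf_\<mu> card_of_Field_ordLeq[OF Card_order_\<mu>]])

lemma greater_exists: "\<gamma> \<in> X \<Longrightarrow> \<exists>\<delta>\<in>X. \<gamma> \<in> underS \<kappa> \<delta>"
  using infinite_Card_order_limit[OF Card_order_\<kappa>] Cinfinite_\<kappa> unfolding cinfinite_def underS_def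
  by blast

definition rank :: "'k \<Rightarrow> 'k \<Rightarrow> 'a" where
  "rank x y = (SOME k. k \<in> Field (cf \<mu>) \<and> idx x y \<in> underS \<mu> k)"

definition below_rank :: "'a \<Rightarrow> 'k \<Rightarrow> 'k set" where
  "below_rank k x = {y\<in>underS \<kappa> x. (rank x y, k) \<in> cf \<mu>}"

lemma
  assumes "x \<in> X"
  shows rank_Field: "rank x y \<in> Field (cf \<mu>)" and idx_less_rank: "idx x y \<in> underS \<mu> (rank x y)"
proof -
  have "\<exists>k. k \<in> Field (cf \<mu>) \<and> idx x y \<in> underS \<mu> k"
    using cf_exceeds[OF Cinfinite_\<mu> idx_Field[OF assms]] by blast
  then have "rank x y \<in> Field (cf \<mu>) \<and> idx x y \<in> underS \<mu> (rank x y)"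
    unfolding rank_def by (rule someI_ex)
  then show "rank x y \<in> Field (cf \<mu>)" "idx x y \<in> underS \<mu> (rank x y)" by blast+
qed

lemma below_rank_subset: "below_rank k x \<subseteq> underS \<kappa> x"
  unfolding below_rank_def by blast

lemma card_of_below_rank:
  assumes x_in_X: "x \<in> X" and k_in_cf: "k \<in> Field (cf \<mu>)"
  shows "|below_rank k x| <o \<mu>"
proof -
  have "under (cf \<mu>) k \<subseteq> Field \<mu>" by (rule subset_trans[OF under_Field Field_cf_\<mu>])
  then obtain b where b_in_Field: "b \<in> Field \<mu>" and under_k_subset: "under (cf \<mu>) k \<subseteq> underS \<mu> b"
    using ordLess_cf_bounded[OF Cinfinite_\<mu>] card_of_under[OF Cinfinite_cf[OF Cinfinite_\<mu>] k_in_cf]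
    by blast
  have "idx x y \<in> underS \<mu> b" if "y \<in> below_rank k x" for y
  proof -
    have "rank x y \<in> underS \<mu> b"
      using that under_k_subset unfolding below_rank_def under_def by blast
    then show ?thesis
      by (rule underS_le_trans[OF Well_order_\<mu> idx_less_rank[OF x_in_X] underS_imp_le])
  qed
  then have "idx x ` below_rank k x \<subseteq> underS \<mu> b" by blast
  with inj_on_subset[OF inj_on_idx[OF x_in_X] below_rank_subset] show ?thesis
    using card_of_underS[OF Card_order_\<mu> b_in_Field] by (rule card_of_inj_ordLess)
qed

subsection \<open>Rank systems\<close>

text \<open>
  The sets \<open>a k x\<close> represent sets of ordinals in the generic ultrapower whose parts below \<open>\<kappa>\<close> are
  bounded but have suprema that are cofinal in \<open>\<kappa>\<close>.
\<close>

definition rank_system :: "('a \<Rightarrow> 'k \<Rightarrow> 'k set) \<Rightarrow> 'k set \<Rightarrow> bool" where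
  "rank_system a q \<longleftrightarrow>
    (\<forall>k\<in>Field (cf \<mu>). dense_below (\<lambda>p. \<exists>\<gamma>\<in>X. bounded_by (a k) \<gamma> p) q) \<and>
    (\<forall>\<gamma>\<in>X. dense_below (\<lambda>p. \<exists>k\<in>Field (cf \<mu>). \<exists>\<delta>. \<gamma> \<in> underS \<kappa> \<delta> \<and> (\<forall>x\<in>p. \<delta> \<in> a k x)) q)"

lemma rank_system_mono: "rank_system a q \<Longrightarrow> q' \<subseteq> q \<Longrightarrow> rank_system a q'"
  using dense_below_mono unfolding rank_system_def by blast

lemma rank_system_below_rank:
  assumes "\<And>k. k \<in> Field (cf \<mu>) \<Longrightarrow> dense_below (\<lambda>p. \<exists>\<gamma>\<in>X. bounded_by (below_rank k) \<gamma> p) q"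
  shows "rank_system below_rank q"
  unfolding rank_system_def dense_below_def[of "\<lambda>p. \<exists>k\<in>Field (cf \<mu>). _ k p"]
proof (intro conjI ballI allI impI assms)
  fix \<gamma> p assume \<gamma>_in_X: "\<gamma> \<in> X" and p_pos: "p \<in> pos"
  obtain \<delta> where \<delta>_in_X: "\<delta> \<in> X" and \<gamma>_less_\<delta>: "\<gamma> \<in> underS \<kappa> \<delta>"
    using greater_exists[OF \<gamma>_in_X] by blast
  have Diff_pos: "p - under \<kappa> \<delta> \<in> pos" by (rule pos_Diff_null[OF p_pos null_under[OF \<delta>_in_X]])
  then have x_in_X: "x \<in> X" if "x \<in> p - under \<kappa> \<delta>" for x using that unfolding pos_iff by blast
  obtain k where k_in_cf: "k \<in> Field (cf \<mu>)"
    and rank_k_pos: "{x\<in>p - under \<kappa> \<delta>. rank x \<delta> = k} \<in> pos" (is "?p \<in> pos")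
    using pos_pigeonhole[OF Diff_pos card_of_Field_cf_\<mu>, of "\<lambda>x k. rank x \<delta> = k"]
      rank_Field[OF x_in_X] by blast
  have "\<delta> \<in> below_rank k x" if "x \<in> ?p" for x
    using that x_in_X[of x] \<delta>_in_X Well_order_not_le_iff[OF Well_order_\<kappa>, of x \<delta>]
      Well_order_refl[OF Well_order_cf_\<mu> k_in_cf]
    unfolding below_rank_def under_def by blast
  then show "\<exists>p'\<subseteq>p. p' \<in> pos \<and> (\<exists>k\<in>Field (cf \<mu>). \<exists>\<delta>. \<gamma> \<in> underS \<kappa> \<delta> \<and> (\<forall>x\<in>p'. \<delta> \<in> below_rank k x))"
    using k_in_cf rank_k_pos \<gamma>_less_\<delta> by (intro exI[of _ ?p]) blast
qed

lemma cofinal_subsequence_exceeds: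
  assumes sequence: "cofinal_sequence C z q" and t_into_C: "t \<in> T \<rightarrow> C"
    and t_cofinal: "\<And>c. c \<in> C \<Longrightarrow> \<exists>k\<in>T. (c, t k) \<in> \<mu>"
    and card_T: "|T| \<le>o \<mu>" and \<gamma>_in_X: "\<gamma> \<in> X" and p_subset_q: "p \<subseteq> q" and p_pos: "p \<in> pos"
  shows "\<exists>k\<in>T. {x\<in>p. \<gamma> \<in> underS \<kappa> (z x (t k))} \<in> pos"
proof -
  obtain b where b_in_X: "b \<in> X" and \<gamma>_less_b: "\<gamma> \<in> underS \<kappa> b"
    using greater_exists[OF \<gamma>_in_X] by blast
  let ?p = "p - {x\<in>q. \<forall>c\<in>C. (b, z x c) \<notin> \<kappa>}"
  have "?p \<in> pos" by (rule pos_Diff_null[OF p_pos cofinal_sequence_exceeds[OF sequence b_in_X]])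
  moreover have "\<exists>k\<in>T. \<gamma> \<in> underS \<kappa> (z x (t k))" if x_in_p: "x \<in> ?p" for x
  proof -
    obtain c where c_in_C: "c \<in> C" and b_le_c: "(b, z x c) \<in> \<kappa>" using x_in_p p_subset_q by blast
    obtain k where k_in_T: "k \<in> T" and c_le_k: "(c, t k) \<in> \<mu>" using t_cofinal[OF c_in_C] by blast
    have "(z x c, z x (t k)) \<in> \<kappa>"
      using sequence x_in_p p_subset_q c_in_C k_in_T c_le_k t_into_C
      unfolding cofinal_sequence_def increasing_sequence_def by blast
    then have "(b, z x (t k)) \<in> \<kappa>" by (rule Well_order_trans[OF Well_order_\<kappa> b_le_c])
    then show ?thesis using underS_le_trans[OF Well_order_\<kappa> \<gamma>_less_b] k_in_T by blast
  qed
  ultimately obtain k where k_in_T: "k \<in> T"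
    and k_exceeds_pos: "{x\<in>?p. \<gamma> \<in> underS \<kappa> (z x (t k))} \<in> pos"
    using pos_pigeonhole[OF _ card_T, of ?p "\<lambda>x k. \<gamma> \<in> underS \<kappa> (z x (t k))"] by blast
  have "{x\<in>p. \<gamma> \<in> underS \<kappa> (z x (t k))} \<in> pos"
    by (rule pos_superset[OF k_exceeds_pos]) (use p_pos in \<open>auto simp: pos_iff\<close>)
  then show ?thesis using k_in_T by blast
qed

lemma rank_system_of_cofinal_sequence:
  assumes sequence: "cofinal_sequence C z q" and "\<not> cofinally_bounded \<mu> C"
  shows "\<exists>a. rank_system a q"
proof -
  have "C \<subseteq> Field \<mu>" using sequence unfolding cofinal_sequence_def by blast
  then obtain t where t_into_C: "t \<in> Field (cf \<mu>) \<rightarrow> C"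
    and t_cofinal: "\<And>c. c \<in> C \<Longrightarrow> \<exists>k\<in>Field (cf \<mu>). (c, t k) \<in> \<mu>"
    using cofinal_map_of_not_cofinally_bounded[OF Cinfinite_\<mu> _ assms(2)] by blast
  have const: "densely_constant (\<lambda>x. z x (t k)) q" if "k \<in> Field (cf \<mu>)" for k
    using sequence that t_into_C unfolding cofinal_sequence_def by blast
  have "dense_below (\<lambda>p. \<exists>\<gamma>\<in>X. bounded_by (\<lambda>x. {z x (t k)}) \<gamma> p) q"
    if k_in_cf: "k \<in> Field (cf \<mu>)" for k
    unfolding dense_below_def
  proof (intro allI impI)
    fix p assume "p \<subseteq> q" "p \<in> pos"
    then obtain p' \<gamma> where p'_subset_p: "p' \<subseteq> p" and p'_pos: "p' \<in> pos" and \<gamma>_in_X: "\<gamma> \<in> X"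
      and z_eq_\<gamma>: "\<forall>x\<in>p'. z x (t k) = \<gamma>"
      using densely_constantD[OF const[OF k_in_cf], of p] by blast
    then have "bounded_by (\<lambda>x. {z x (t k)}) \<gamma> p'" by (intro bounded_byI) (auto simp: underS_def)
    then show "\<exists>p'\<subseteq>p. p' \<in> pos \<and> (\<exists>\<gamma>\<in>X. bounded_by (\<lambda>x. {z x (t k)}) \<gamma> p')"
      using p'_subset_p p'_pos \<gamma>_in_X z_eq_\<gamma> by blast
  qed
  moreover have "dense_below (\<lambda>p. \<exists>k\<in>Field (cf \<mu>). \<exists>\<delta>. \<gamma> \<in> underS \<kappa> \<delta> \<and> (\<forall>x\<in>p. \<delta> \<in> {z x (t k)})) q"
    if \<gamma>_in_X: "\<gamma> \<in> X" for \<gamma>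
    unfolding dense_below_def
  proof (intro allI impI)
    fix p assume p_subset_q: "p \<subseteq> q" and p_pos: "p \<in> pos"
    obtain k where k_in_cf: "k \<in> Field (cf \<mu>)"
      and k_exceeds_pos: "{x\<in>p. \<gamma> \<in> underS \<kappa> (z x (t k))} \<in> pos" (is "?p \<in> pos")
      using cofinal_subsequence_exceeds[OF sequence t_into_C t_cofinal card_of_Field_cf_\<mu> \<gamma>_in_X
        p_subset_q p_pos] by blast
    have "?p \<subseteq> q" using p_subset_q by blast
    then obtain p' \<delta> where p'_subset_p: "p' \<subseteq> ?p" and p'_pos: "p' \<in> pos"
      and z_eq_\<delta>: "\<forall>x\<in>p'. z x (t k) = \<delta>"
      using densely_constantD[OF const[OF k_in_cf] _ k_exceeds_pos] by blast
    then have "\<gamma> \<in> underS \<kappa> \<delta>" using pos_nonempty[OF p'_pos] by fastforce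
    then show "\<exists>p'\<subseteq>p. p' \<in> pos \<and> (\<exists>k\<in>Field (cf \<mu>). \<exists>\<delta>. \<gamma> \<in> underS \<kappa> \<delta> \<and> (\<forall>x\<in>p'. \<delta> \<in> {z x (t k)}))"
      using p'_subset_p p'_pos z_eq_\<delta> k_in_cf
      by (intro exI[of _ p'] conjI bexI[of _ k] exI[of _ \<delta>]) auto
  qed
  ultimately have "rank_system (\<lambda>k x. {z x (t k)}) q" unfolding rank_system_def by blast
  then show ?thesis by blast
qed

lemma cofinal_sequence_or_rank_system:
  assumes "A \<in> pos"
  shows "\<exists>q\<subseteq>A. q \<in> pos \<and> (has_cofinal_sequence q \<or> (\<exists>a. rank_system a q))"
proof (cases "\<forall>k\<in>Field (cf \<mu>). dense_below (\<lambda>p. \<exists>\<gamma>\<in>X. bounded_by (below_rank k) \<gamma> p) A")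
  case True
  then show ?thesis using rank_system_below_rank[of A] assms by blast
next
  case False
  then obtain k where k_in_cf: "k \<in> Field (cf \<mu>)"
    and "\<not> dense_below (\<lambda>p. \<exists>\<gamma>\<in>X. bounded_by (below_rank k) \<gamma> p) A" by blast
  then obtain q where q_subset_A: "q \<subseteq> A" and q_pos: "q \<in> pos"
    and nowhere_bounded: "nowhere_bounded (below_rank k) q"
    using not_dense_below_bounded by blast
  have "below_rank k x \<subseteq> X \<and> |below_rank k x| <o \<mu>" if "x \<in> q" for x
  proof
    show "below_rank k x \<subseteq> X"
      by (rule subset_trans[OF below_rank_subset Order_Relation.underS_Field])
    show "|below_rank k x| <o \<mu>"
      using q_pos that unfolding pos_iff by (intro card_of_below_rank k_in_cf) blast
  qed
  then obtain C z p where p_subset_q: "p \<subseteq> q" and p_pos: "p \<in> pos"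
    and sequence: "cofinal_sequence C z p"
    using nowhere_bounded_cofinal_sequence[OF q_pos _ nowhere_bounded] by blast
  then show ?thesis
    using rank_system_of_cofinal_sequence[OF sequence] q_subset_A unfolding has_cofinal_sequence_def
    by blast
qed

definition rank_witness :: "('a \<Rightarrow> 'k \<Rightarrow> 'k set) \<Rightarrow> 'k \<Rightarrow> 'a \<Rightarrow> 'k \<Rightarrow> 'k \<Rightarrow> 'k set \<Rightarrow> bool" where
  "rank_witness a i c \<delta> \<gamma> p \<longleftrightarrow> c \<in> Field (cf \<mu>) \<and> i \<in> underS \<kappa> \<delta> \<and> \<gamma> \<in> X \<and> p \<in> pos \<and>
    (\<forall>x\<in>p. \<delta> \<in> a c x) \<and> bounded_by (a c) \<gamma> p \<and> (\<forall>l\<in>underS (cf \<mu>) c. bounded_by (a l) i p)"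

lemma rank_witness_exists:
  assumes i_in_X: "i \<in> X" and A_pos: "A \<in> pos" and A_system: "rank_system a A"
  shows "\<exists>c \<delta> \<gamma>. \<exists>p\<subseteq>A. rank_witness a i c \<delta> \<gamma> p"
proof -
  have dense: "dense_below (\<lambda>p. \<exists>k\<in>Field (cf \<mu>). \<exists>\<delta>. i \<in> underS \<kappa> \<delta> \<and> (\<forall>x\<in>p. \<delta> \<in> a k x)) A"
    using A_system i_in_X unfolding rank_system_def by blast
  have bounded: "dense_below (\<lambda>p. \<exists>\<gamma>\<in>X. bounded_by (a k) \<gamma> p) A" if "k \<in> Field (cf \<mu>)" for k
    using A_system that unfolding rank_system_def by blast
  define S where "S = {k\<in>Field (cf \<mu>). \<exists>\<delta>. i \<in> underS \<kappa> \<delta> \<and> {x\<in>A. \<delta> \<in> a k x} \<in> pos}"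
  obtain k p \<delta> where p_subset_A: "p \<subseteq> A" and p_pos: "p \<in> pos" and k_in_cf: "k \<in> Field (cf \<mu>)"
    and i_less_\<delta>: "i \<in> underS \<kappa> \<delta>" and \<delta>_in_a: "\<forall>x\<in>p. \<delta> \<in> a k x"
    using dense_belowD[OF dense A_pos] by blast
  have "{x\<in>A. \<delta> \<in> a k x} \<in> pos"
    by (rule pos_superset[OF p_pos]) (use p_subset_A \<delta>_in_a A_pos in \<open>auto simp: pos_iff\<close>)
  then have "k \<in> S" using k_in_cf i_less_\<delta> \<delta>_in_a unfolding S_def by blast
  then obtain c where c_in_S: "c \<in> S" and least: "\<And>l. l \<in> S \<Longrightarrow> (c, l) \<in> cf \<mu>"
    using Well_order_least[OF Well_order_cf_\<mu>, of S] unfolding S_def by blast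
  obtain \<delta> where c_in_cf: "c \<in> Field (cf \<mu>)" and i_less_\<delta>: "i \<in> underS \<kappa> \<delta>"
    and \<delta>_pos: "{x\<in>A. \<delta> \<in> a c x} \<in> pos"
    using c_in_S unfolding S_def by blast
  have "{x\<in>A. \<delta> \<in> a c x} \<subseteq> A" by blast
  then obtain p \<gamma> where p_subset: "p \<subseteq> {x\<in>A. \<delta> \<in> a c x}" and p_pos: "p \<in> pos" and \<gamma>_in_X: "\<gamma> \<in> X"
    and p_bounded: "bounded_by (a c) \<gamma> p"
    using dense_belowD[OF dense_below_mono[OF bounded[OF c_in_cf]] \<delta>_pos] by blast
  have "bounded_by (a l) i p" if l_less_c: "l \<in> underS (cf \<mu>) c" for l
  proof (rule bounded_by_mono[of _ _ A])
    have "l \<notin> S"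
      using least Well_order_not_le_iff[OF Well_order_cf_\<mu>] underS_imp_Field[OF l_less_c] l_less_c
      by blast
    then show "bounded_by (a l) i A"
      using underS_imp_Field[OF l_less_c] A_pos unfolding S_def bounded_by_def pos_iff by blast
  qed (use p_subset in blast)
  then have "rank_witness a i c \<delta> \<gamma> p"
    using c_in_cf i_less_\<delta> p_subset p_pos \<gamma>_in_X p_bounded unfolding rank_witness_def by blast
  then show ?thesis using p_subset by blast
qed

lemma rank_witness_overlap:
  assumes "rank_witness a j c \<delta> \<gamma> p" "bounded_by (a c) \<beta> q" "q \<inter> p \<notin> I" "\<beta> \<in> X"
  shows "j \<in> underS \<kappa> \<beta>"
proof -
  have j_less_\<delta>: "j \<in> underS \<kappa> \<delta>" and \<delta>_in_a: "\<forall>x\<in>p. \<delta> \<in> a c x"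
    using assms(1) unfolding rank_witness_def by blast+
  then have "(\<delta>, \<beta>) \<in> \<kappa>"
    using assms(2-4) underS_imp_Field[OF j_less_\<delta>]
    by (intro bounded_by_overlap[of "a c"]) (auto simp: Int_commute)
  then show ?thesis by (rule underS_le_trans[OF Well_order_\<kappa> j_less_\<delta>])
qed

lemma rank_witness_overlap_le:
  assumes p_witness: "rank_witness a i c \<delta> \<gamma> p" and q_witness: "rank_witness a j c' \<delta>' \<gamma>' q"
    and i_less_j: "i \<in> underS \<kappa> j" and overlap: "p \<inter> q \<notin> I"
  shows "(c, c') \<in> cf \<mu>"
proof (rule ccontr)
  assume "(c, c') \<notin> cf \<mu>"
  then have "c' \<in> underS (cf \<mu>) c"
    using p_witness q_witness Well_order_not_le_iff[OF Well_order_cf_\<mu>] unfolding rank_witness_def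
    by blast
  then have "bounded_by (a c') i p" using p_witness unfolding rank_witness_def by blast
  then have "j \<in> underS \<kappa> i"
    using rank_witness_overlap[OF q_witness] overlap underS_imp_Field[OF i_less_j] by blast
  then show False
    using i_less_j Well_order_not_le_iff[OF Well_order_\<kappa>] underS_imp_le underS_imp_Field by metis
qed

lemma rank_system_refinement:
  assumes J_subset_X: "J \<subseteq> X" and A_pos: "\<And>i. i \<in> J \<Longrightarrow> A i \<in> pos"
    and A_system: "\<And>i. i \<in> J \<Longrightarrow> rank_system (a i) (A i)"
  shows "\<exists>B c. pos_refinement J B A \<and> c \<in> J \<rightarrow> Field (cf \<mu>) \<and>
    (\<forall>i\<in>J. \<forall>j\<in>J. i \<in> underS \<kappa> j \<longrightarrow> a i = a j \<longrightarrow> B i \<inter> B j \<in> I \<or> c i \<in> underS (cf \<mu>) (c j))"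
proof -
  have "\<exists>c \<delta> \<gamma>. \<exists>p\<subseteq>A i. rank_witness (a i) i c \<delta> \<gamma> p" if "i \<in> J" for i
    using rank_witness_exists[OF _ A_pos[OF that] A_system[OF that]] that J_subset_X by blast
  then obtain c \<delta> \<gamma> p where p_subset: "\<And>i. i \<in> J \<Longrightarrow> p i \<subseteq> A i"
    and witness: "\<And>i. i \<in> J \<Longrightarrow> rank_witness (a i) i (c i) (\<delta> i) (\<gamma> i) (p i)" by metis
  have p_pos: "p i \<in> pos" if "i \<in> J" for i
    using witness[OF that] unfolding rank_witness_def by blast
  define R where "R = {(i, j). i \<in> J \<and> j \<in> J \<and> a i = a j \<and> c i = c j \<and> p i \<inter> p j \<notin> I}"
  have "|R `` {i}| \<le>o \<mu>" if i_in_J: "i \<in> J" for i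
  proof -
    have \<gamma>_in_X: "\<gamma> i \<in> X" and p_bounded: "bounded_by (a i (c i)) (\<gamma> i) (p i)"
      using witness[OF i_in_J] unfolding rank_witness_def by blast+
    have "R `` {i} \<subseteq> underS \<kappa> (\<gamma> i)"
      using rank_witness_overlap[OF witness _ _ \<gamma>_in_X] p_bounded unfolding R_def by auto
    then show ?thesis by (rule card_of_subset_ordLeq[OF _ card_of_underS_\<kappa>[OF \<gamma>_in_X]])
  qed
  moreover have "R \<subseteq> J \<times> J" "sym R" unfolding R_def sym_def by (auto simp: Int_commute)
  ultimately obtain B where B_refines_p: "pos_refinement J B p"
    and B_disjoint: "\<And>i j. (i, j) \<in> R \<Longrightarrow> i \<noteq> j \<Longrightarrow> B i \<inter> B j = {}"
    using small_degree_refinement[of R J p] p_pos by blast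
  have "c i \<in> underS (cf \<mu>) (c j)"
    if i_in_J: "i \<in> J" and j_in_J: "j \<in> J" and i_less_j: "i \<in> underS \<kappa> j" and a_eq: "a i = a j"
      and overlap: "B i \<inter> B j \<notin> I" for i j
  proof -
    have "B i \<inter> B j \<subseteq> p i \<inter> p j"
      using B_refines_p i_in_J j_in_J unfolding pos_refinement_def by blast
    then have p_overlap: "p i \<inter> p j \<notin> I" using overlap null_subset by blast
    have "B i \<inter> B j \<noteq> {}" "i \<noteq> j" using overlap null_empty i_less_j unfolding underS_def by auto
    then have "c i \<noteq> c j"
      using B_disjoint[of i j] i_in_J j_in_J i_less_j a_eq p_overlap unfolding R_def by blast
    moreover have "(c i, c j) \<in> cf \<mu>"
      using rank_witness_overlap_le[OF witness[OF i_in_J] _ i_less_j p_overlap] witness[OF j_in_J]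
        a_eq by simp
    ultimately show ?thesis unfolding underS_def by blast
  qed
  moreover have "pos_refinement J B A"
    using pos_refinement_trans[OF B_refines_p] p_subset p_pos unfolding pos_refinement_def by blast
  moreover have "c \<in> J \<rightarrow> Field (cf \<mu>)" using witness unfolding rank_witness_def by blast
  ultimately show ?thesis by (intro exI[of _ B] exI[of _ c]) blast
qed

definition ranked_family :: "('k \<Rightarrow> 'k set) \<Rightarrow> ('k \<Rightarrow> 'a) \<Rightarrow> bool" where
  "ranked_family B c \<longleftrightarrow> c \<in> X \<rightarrow> Field (cf \<mu>) \<and>
    (\<forall>i\<in>X. \<forall>j\<in>X. i \<in> underS \<kappa> j \<longrightarrow> B i \<inter> B j = {} \<or> c i \<in> underS (cf \<mu>) (c j))"

lemma almost_ranked_refinement: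
  assumes A_pos: "\<And>i. i \<in> X \<Longrightarrow> A i \<in> pos"
  shows "\<exists>B c. pos_refinement X B A \<and> c \<in> X \<rightarrow> Field (cf \<mu>) \<and>
    (\<forall>i\<in>X. \<forall>j\<in>X. i \<in> underS \<kappa> j \<longrightarrow> B i \<inter> B j \<in> I \<or> c i \<in> underS (cf \<mu>) (c j))"
proof -
  obtain q a where q_refines_A: "pos_refinement X q A"
    and kinds:
      "pairwise (\<lambda>i j. q i \<inter> q j \<in> I \<or> a i = a j \<and> rank_system (a i) (q i) \<and>
      rank_system (a j) (q j)) X"
    using refinement_by_kinds_modulo_cofinal_sequences[of X rank_system A] rank_system_mono
      cofinal_sequence_or_rank_system[OF A_pos] card_of_Field_ordLeq[OF Card_order_\<kappa>] by blast
  define J where "J = {i\<in>X. rank_system (a i) (q i)}"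
  have "J \<subseteq> X" "\<And>i. i \<in> J \<Longrightarrow> q i \<in> pos" "\<And>i. i \<in> J \<Longrightarrow> rank_system (a i) (q i)"
    using q_refines_A unfolding J_def pos_refinement_def by blast+
  then obtain D c where D_refines_q: "pos_refinement J D q" and c_into_cf: "c \<in> J \<rightarrow> Field (cf \<mu>)"
    and c_increasing:
      "\<And>i j. i \<in> J \<Longrightarrow> j \<in> J \<Longrightarrow> i \<in> underS \<kappa> j \<Longrightarrow> a i = a j \<Longrightarrow> D i \<inter> D j \<in> I \<or> c i \<in> underS (cf \<mu>) (c j)"
    using rank_system_refinement[of J q a] by blast
  obtain k0 where k0_in_cf: "k0 \<in> Field (cf \<mu>)"
    using Cinfinite_cf[OF Cinfinite_\<mu>] unfolding cinfinite_def by fastforce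
  define B where "B i = (if i \<in> J then D i else q i)" for i
  define c' where "c' i = (if i \<in> J then c i else k0)" for i
  have B_refines_q: "pos_refinement X B q"
    using D_refines_q q_refines_A unfolding pos_refinement_def B_def by auto
  have "B i \<inter> B j \<in> I \<or> c' i \<in> underS (cf \<mu>) (c' j)" if i_in_X: "i \<in> X" and j_in_X: "j \<in> X"
    and i_less_j: "i \<in> underS \<kappa> j" for i j
  proof (cases "q i \<inter> q j \<in> I")
    case True
    then have "B i \<inter> B j \<in> I"
      by (rule null_subset)
        (use B_refines_q i_in_X j_in_X i_less_j in \<open>auto simp: pos_refinement_def\<close>)
    then show ?thesis ..
  next
    case False
    have "i \<noteq> j" using i_less_j unfolding underS_def by blast
    then have "a i = a j" "i \<in> J" "j \<in> J"
      using kinds False i_in_X j_in_X i_less_j unfolding pairwise_def J_def by auto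
    then show ?thesis using c_increasing[of i j] i_less_j unfolding B_def c'_def by simp
  qed
  moreover have "c' \<in> X \<rightarrow> Field (cf \<mu>)" using c_into_cf k0_in_cf unfolding c'_def by auto
  ultimately show ?thesis using pos_refinement_trans[OF B_refines_q q_refines_A] by blast
qed

lemma disjoint_pos_refinement_\<kappa>:
  assumes "\<And>i. i \<in> X \<Longrightarrow> B i \<in> pos"
  shows "\<exists>C. pos_refinement X C B \<and> pairwise (\<lambda>i j. B i \<inter> B j \<in> I \<longrightarrow> C i \<inter> C j = {}) X"
  using disjoint_pos_refinement[OF Well_order_\<kappa> card_of_underS_\<kappa>] assms by blast

lemma ranked_refinement:
  assumes A_pos: "\<And>i. i \<in> X \<Longrightarrow> A i \<in> pos"
  shows "\<exists>B c. pos_refinement X B A \<and> ranked_family B c"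
proof -
  obtain B c where B_refines_A: "pos_refinement X B A" and c_into_cf: "c \<in> X \<rightarrow> Field (cf \<mu>)"
    and c_increasing:
      "\<And>i j. i \<in> X \<Longrightarrow> j \<in> X \<Longrightarrow> i \<in> underS \<kappa> j \<Longrightarrow> B i \<inter> B j \<in> I \<or> c i \<in> underS (cf \<mu>) (c j)"
    using almost_ranked_refinement[of A] A_pos by blast
  obtain C where C_refines_B: "pos_refinement X C B"
    and C_disjoint: "pairwise (\<lambda>i j. B i \<inter> B j \<in> I \<longrightarrow> C i \<inter> C j = {}) X"
    using disjoint_pos_refinement_\<kappa>[of B] B_refines_A unfolding pos_refinement_def by blast
  have "C i \<inter> C j = {} \<or> c i \<in> underS (cf \<mu>) (c j)"
    if "i \<in> X" "j \<in> X" and i_less_j: "i \<in> underS \<kappa> j" for i j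
  proof -
    have "i \<noteq> j" using i_less_j unfolding underS_def by blast
    then show ?thesis using c_increasing[of i j] C_disjoint that unfolding pairwise_def by blast
  qed
  then have "ranked_family C c" using c_into_cf unfolding ranked_family_def by blast
  then show ?thesis using pos_refinement_trans[OF C_refines_B B_refines_A] by blast
qed

lemma cofinally_bounded_if_ordLess_cf:
  assumes C_subset: "C \<subseteq> Field \<mu>" and card_C: "|C| <o cf \<mu>"
  shows "cofinally_bounded \<mu> C"
  unfolding cofinally_bounded_def
proof
  fix s assume "s \<in> C \<rightarrow> Field \<mu>"
  then obtain b where "b \<in> Field \<mu>" "s ` C \<subseteq> underS \<mu> b"
    using ordLess_cf_bounded[OF Cinfinite_\<mu>, of "s ` C"] card_of_image_ordLess[OF card_C] by blast
  then show "\<exists>\<xi>\<in>Field \<mu>. \<forall>c\<in>C. \<exists>d\<in>C. (c, d) \<in> \<mu> \<and> s d \<in> underS \<mu> \<xi>"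
    using Well_order_refl[OF Well_order_\<mu>] C_subset by blast
qed

lemma cofinal_sequence_or_bounded:
  assumes A_pos: "A \<in> pos" and small: "\<And>x. x \<in> A \<Longrightarrow> Z x \<subseteq> X \<and> |Z x| <o cf \<mu>"
  shows "\<exists>q\<subseteq>A. q \<in> pos \<and> (has_cofinal_sequence q \<or> (\<exists>\<gamma>\<in>X. bounded_by Z \<gamma> q))"
proof (cases "dense_below (\<lambda>p. \<exists>\<gamma>\<in>X. bounded_by Z \<gamma> p) A")
  case True
  then show ?thesis using dense_belowD[OF _ A_pos] by blast
next
  case False
  then obtain q where q_subset_A: "q \<subseteq> A" and q_pos: "q \<in> pos"
    and nowhere_bounded: "nowhere_bounded Z q" using not_dense_below_bounded by blast
  have "Z x \<subseteq> X \<and> |Z x| <o \<mu>" if "x \<in> q" for x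
    using small q_subset_A that ordLess_ordLeq_trans[OF _ cf_ordLeq[OF Cinfinite_\<mu>]] by blast
  then obtain C z p x where p_subset_q: "p \<subseteq> q" and p_pos: "p \<in> pos"
    and sequence: "cofinal_sequence C z p" and x_in_q: "x \<in> q" and card_C: "|C| \<le>o |Z x|"
    using nowhere_bounded_cofinal_sequence[OF q_pos _ nowhere_bounded] by blast
  have "|C| <o cf \<mu>" using ordLeq_ordLess_trans[OF card_C] small x_in_q q_subset_A by blast
  then have "cofinally_bounded \<mu> C"
    using sequence cofinally_bounded_if_ordLess_cf unfolding cofinal_sequence_def by blast
  then show ?thesis
    using p_subset_q p_pos sequence q_subset_A unfolding has_cofinal_sequence_def by blast
qed

lemma small_overlap_refinement:
  assumes A_pos: "\<And>i. i \<in> X \<Longrightarrow> A i \<in> pos"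
    and small: "\<And>i. i \<in> X \<Longrightarrow> |{j\<in>X. i \<noteq> j \<and> A i \<inter> A j \<notin> I}| \<le>o \<mu>"
  shows "\<exists>B. pos_refinement X B A \<and> disjoint_family_on B X"
proof -
  define R where "R = {(i, j). i \<in> X \<and> j \<in> X \<and> i \<noteq> j \<and> A i \<inter> A j \<notin> I}"
  have "|R `` {i}| \<le>o \<mu>" if "i \<in> X" for i
    by (rule card_of_subset_ordLeq[OF _ small[OF that]]) (auto simp: R_def)
  moreover have "R \<subseteq> X \<times> X" "sym R" unfolding R_def sym_def by (auto simp: Int_commute)
  ultimately obtain D where D_refines_A: "pos_refinement X D A"
    and D_disjoint: "\<And>i j. (i, j) \<in> R \<Longrightarrow> i \<noteq> j \<Longrightarrow> D i \<inter> D j = {}"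
    using small_degree_refinement[of R X A] A_pos by blast
  have "D i \<inter> D j \<in> I" if "i \<in> X" "j \<in> X" "i \<noteq> j" for i j
  proof (cases "(i, j) \<in> R")
    case True
    then show ?thesis using D_disjoint that(3) null_empty by simp
  next
    case False
    then have "A i \<inter> A j \<in> I" using that unfolding R_def by blast
    then show ?thesis
      by (rule null_subset) (use D_refines_A that in \<open>auto simp: pos_refinement_def\<close>)
  qed
  moreover obtain B where B_refines_D: "pos_refinement X B D"
    and B_disjoint: "pairwise (\<lambda>i j. D i \<inter> D j \<in> I \<longrightarrow> B i \<inter> B j = {}) X"
    using disjoint_pos_refinement_\<kappa>[of D] D_refines_A unfolding pos_refinement_def by blast
  ultimately have "disjoint_family_on B X" unfolding pairwise_def disjoint_family_on_def by blast
  then show ?thesis using pos_refinement_trans[OF B_refines_D D_refines_A] by blast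
qed

lemma point_sparse_refinement:
  assumes A_pos: "\<And>i. i \<in> X \<Longrightarrow> A i \<in> pos" and sparse: "\<And>x. x \<in> X \<Longrightarrow> |{i\<in>X. x \<in> A i}| <o cf \<mu>"
  shows "\<exists>B. pos_refinement X B A \<and> disjoint_family_on B X"
proof -
  define Z where "Z x = {i\<in>X. x \<in> A i}" for x
  define P where "P u q \<longleftrightarrow> (\<exists>\<gamma>\<in>X. bounded_by Z \<gamma> q)" for u :: unit and q
  have "\<exists>q\<subseteq>A i. q \<in> pos \<and> (has_cofinal_sequence q \<or> (\<exists>u. P u q))" if "i \<in> X" for i
    using cofinal_sequence_or_bounded[OF A_pos[OF that], of Z] sparse A_pos[OF that]
    unfolding P_def Z_def pos_iff by blast
  moreover have "P u q'" if "P u q" "q' \<subseteq> q" for u q q'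
    using that bounded_by_mono unfolding P_def by blast
  ultimately obtain q k where q_refines_A: "pos_refinement X q A"
    and kinds: "pairwise (\<lambda>i j. q i \<inter> q j \<in> I \<or> k i = k j \<and> P (k i) (q i) \<and> P (k j) (q j)) X"
    using refinement_by_kinds_modulo_cofinal_sequences[of X P A]
      card_of_Field_ordLeq[OF Card_order_\<kappa>] by blast
  have "|{j\<in>X. i \<noteq> j \<and> q i \<inter> q j \<notin> I}| \<le>o \<mu>" (is "|?N| \<le>o \<mu>") if i_in_X: "i \<in> X" for i
  proof (cases "?N = {}")
    case True
    show ?thesis unfolding True by (rule Card_order_empty[OF Card_order_\<mu>])
  next
    case False
    then have "P (k i) (q i)" using kinds i_in_X unfolding pairwise_def by blast
    then obtain \<gamma> where \<gamma>_in_X: "\<gamma> \<in> X" and q_bounded: "bounded_by Z \<gamma> (q i)"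
      unfolding P_def by blast
    have "(j, \<gamma>) \<in> \<kappa>" if "j \<in> ?N" for j
    proof (rule bounded_by_overlap[OF q_bounded _ _ \<gamma>_in_X])
      show "j \<in> X" "q j \<inter> q i \<notin> I" using that by (auto simp: Int_commute)
      then show "j \<in> Z x" if "x \<in> q j" for x
        using q_refines_A that unfolding pos_refinement_def Z_def by blast
    qed
    then have "?N \<subseteq> under \<kappa> \<gamma>" unfolding under_def by blast
    then show ?thesis by (rule card_of_subset_ordLeq[OF _ card_of_under_\<kappa>[OF \<gamma>_in_X]])
  qed
  then obtain B where "pos_refinement X B q" "disjoint_family_on B X"
    using small_overlap_refinement[of q] q_refines_A unfolding pos_refinement_def by blast
  then show ?thesis using pos_refinement_trans[OF _ q_refines_A] by blast
qed

end

section \<open>Regularity\<close>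

context succ_complete_ideal
begin

lemma regular2_iff: "regular2 X I \<alpha> \<beta> \<longleftrightarrow> (\<forall>A. (\<forall>i\<in>Field \<beta>. A i \<in> pos) \<longrightarrow>
    (\<exists>B. pos_refinement (Field \<beta>) B A \<and> (\<forall>z\<subseteq>Field \<beta>. Restr \<beta> z =o \<alpha> \<longrightarrow> X \<inter> (\<Inter>i\<in>z. B i) = {})))"
  unfolding regular2_def refinement_def pos_refinement_def ball_conj_distrib
  by (simp add: conj_ac imp_conjL)

lemma regular3_iff: "regular3 X I \<alpha> \<beta> \<gamma> \<longleftrightarrow> (\<forall>A. (\<forall>i\<in>Field \<gamma>. A i \<in> pos) \<longrightarrow>
    (\<exists>B. pos_refinement (Field \<gamma>) B A \<and> (\<forall>x\<subseteq>Field \<gamma>. Restr \<gamma> x =o \<beta> \<longrightarrow> |X \<inter> (\<Inter>i\<in>x. B i)| \<le>o \<alpha>)))"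
  unfolding regular3_def refinement_def pos_refinement_def ball_conj_distrib
  by (simp add: conj_ac imp_conjL)

lemma regular2_2I:
  assumes Well_order_\<delta>: "Well_order \<delta>"
    and disjoint_refinement: "\<And>A. \<forall>i\<in>Field \<delta>. A i \<in> pos \<Longrightarrow>
      \<exists>B. pos_refinement (Field \<delta>) B A \<and> disjoint_family_on B (Field \<delta>)"
  shows "regular2 X I (natLeq_on 2) \<delta>"
  unfolding regular2_iff
proof (intro allI impI)
  fix A assume "\<forall>i\<in>Field \<delta>. A i \<in> pos"
  then obtain B where B_refines_A: "pos_refinement (Field \<delta>) B A"
    and disjoint: "disjoint_family_on B (Field \<delta>)" using disjoint_refinement by blast
  have "X \<inter> (\<Inter>i\<in>z. B i) = {}" if z_subset: "z \<subseteq> Field \<delta>" and z_two: "Restr \<delta> z =o natLeq_on 2" for z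
  proof -
    have "|z| =o |{..<2::nat}|"
      using ordIso_Restr_imp_card_of[OF Well_order_\<delta> z_subset z_two]
      unfolding Field_natLeq_on lessThan_def .
    then have "card z = card {..<2::nat}"
      using bij_betw_same_card unfolding card_of_ordIso[symmetric] by blast
    then obtain i j where "z = {i, j}" "i \<noteq> j" using card_2_iff[of z] by auto
    then show ?thesis using disjoint_family_onD[OF disjoint, of i j] z_subset by auto
  qed
  with B_refines_A show "\<exists>B. pos_refinement (Field \<delta>) B A \<and>
    (\<forall>z\<subseteq>Field \<delta>. Restr \<delta> z =o natLeq_on 2 \<longrightarrow> X \<inter> (\<Inter>i\<in>z. B i) = {})" by blast
qed

end

context ideal_on_succ_cardinal
begin

lemma regular2_2_less_\<kappa>:
  assumes "Well_order \<delta>" "\<delta> <o \<kappa>"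
  shows "regular2 X I (natLeq_on 2) \<delta>"
proof (rule regular2_2I[OF assms(1)])
  have "|Field \<delta>| \<le>o \<mu>" using ordLess_Field[OF assms(2)] ordLess_\<kappa>_iff by blast
  then show "\<exists>B. pos_refinement (Field \<delta>) B A \<and> disjoint_family_on B (Field \<delta>)"
    if "\<forall>i\<in>Field \<delta>. A i \<in> pos" for A
    using that by (intro small_disjoint_refinement) simp_all
qed

lemma ranked_family_less:
  assumes "ranked_family B c" "z \<subseteq> X" "\<And>i. i \<in> z \<Longrightarrow> x \<in> B i" "i \<in> z" "j \<in> z" "i \<in> underS \<kappa> j"
  shows "c i \<in> underS (cf \<mu>) (c j)"
proof -
  have "i \<in> X" "j \<in> X" "B i \<inter> B j \<noteq> {}" using assms(2-5) by blast+
  then show ?thesis using assms(1,6) unfolding ranked_family_def by blast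
qed

lemma ranked_family_inj_on:
  assumes "ranked_family B c" "z \<subseteq> X" "\<And>i. i \<in> z \<Longrightarrow> x \<in> B i"
  shows "inj_on c z"
proof (rule inj_onI, rule ccontr)
  fix i j assume i_in_z: "i \<in> z" and j_in_z: "j \<in> z" and c_eq: "c i = c j" and i_neq_j: "i \<noteq> j"
  then have "i \<in> underS \<kappa> j \<or> j \<in> underS \<kappa> i"
    using assms(2) by (intro Well_order_underS_cases[OF Well_order_\<kappa>]) auto
  then show False using ranked_family_less[OF assms] i_in_z j_in_z c_eq underS_notIn by metis
qed

lemma regular2_ordsuc_cf: "regular2 X I (ordsuc (cf \<mu>)) \<kappa>"
  unfolding regular2_iff
proof (intro allI impI)
  fix A assume "\<forall>i\<in>X. A i \<in> pos"
  then obtain B c where B_refines_A: "pos_refinement X B A" and B_ranked: "ranked_family B c"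
    using ranked_refinement by blast
  have "X \<inter> (\<Inter>i\<in>z. B i) = {}" if z_subset_X: "z \<subseteq> X" and z_iso: "Restr \<kappa> z =o ordsuc (cf \<mu>)" for z
  proof (rule ccontr)
    assume "X \<inter> (\<Inter>i\<in>z. B i) \<noteq> {}"
    then obtain x where x_in_B: "\<And>i. i \<in> z \<Longrightarrow> x \<in> B i" by blast
    obtain t where t_in_z: "t \<in> z" and card_cf_le: "|Field (cf \<mu>)| \<le>o |z \<inter> underS \<kappa> t|"
      using ordsuc_ordertype_greatest[OF Well_order_\<kappa> z_subset_X z_iso] by blast
    have "inj_on c z" using x_in_B by (rule ranked_family_inj_on[OF B_ranked z_subset_X])
    then have "inj_on c (z \<inter> underS \<kappa> t)" using Int_lower1 by (rule inj_on_subset)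
    moreover have "c ` (z \<inter> underS \<kappa> t) \<subseteq> underS (cf \<mu>) (c t)"
      using ranked_family_less[OF B_ranked z_subset_X x_in_B _ t_in_z] by blast
    moreover have "|underS (cf \<mu>) (c t)| <o cf \<mu>"
      using B_ranked t_in_z z_subset_X unfolding ranked_family_def
      by (intro card_of_underS Card_order_cf_\<mu>) blast
    ultimately have "|z \<inter> underS \<kappa> t| <o cf \<mu>" by (rule card_of_inj_ordLess)
    then show False
      using ordLeq_ordLess_trans[OF card_cf_le] not_card_of_Field_ordLess[OF Card_order_cf_\<mu>]
      by blast
  qed
  with B_refines_A show "\<exists>B. pos_refinement X B A \<and>
    (\<forall>z\<subseteq>X. Restr \<kappa> z =o ordsuc (cf \<mu>) \<longrightarrow> X \<inter> (\<Inter>i\<in>z. B i) = {})" by blast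
qed

lemma below_rank_free_subset:
  assumes A_pos: "A \<in> pos" and k_in_cf: "k \<in> Field (cf \<mu>)"
  shows "\<exists>B\<subseteq>A. B \<in> pos \<and> (\<forall>x\<in>B. below_rank k x \<inter> B = {})"
proof -
  have "\<exists>\<epsilon>. \<forall>x\<in>X. \<epsilon> x \<in> Field \<mu> \<and> \<epsilon> x \<notin> \<epsilon> ` below_rank k x"
    using card_of_below_rank[OF _ k_in_cf] below_rank_subset Card_order_\<mu>
    by (intro Well_order_choice_avoiding[OF Well_order_\<kappa>]) (auto simp: ordLess_card_of_Field_iff)
  then obtain \<epsilon> where \<epsilon>_avoids: "\<And>x. x \<in> X \<Longrightarrow> \<epsilon> x \<in> Field \<mu> \<and> \<epsilon> x \<notin> \<epsilon> ` below_rank k x" by blast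
  have "\<exists>m\<in>Field \<mu>. {x\<in>A. \<epsilon> x = m} \<in> pos"
    using \<epsilon>_avoids A_pos unfolding pos_iff[of A]
    by (intro pos_pigeonhole[OF A_pos card_of_Field_ordLeq[OF Card_order_\<mu>]]) blast
  then obtain m where m_pos: "{x\<in>A. \<epsilon> x = m} \<in> pos" by blast
  have "below_rank k x \<inter> {x\<in>A. \<epsilon> x = m} = {}" if "x \<in> {x\<in>A. \<epsilon> x = m}" for x
  proof -
    have "x \<in> X" using that A_pos unfolding pos_iff by blast
    then show ?thesis using \<epsilon>_avoids[of x] that by (auto simp: image_iff)
  qed
  then show ?thesis using m_pos by (intro exI[of _ "{x\<in>A. \<epsilon> x = m}"]) blast
qed

text \<open>
  If \<open>y < x\<close> both lie in \<open>cf \<mu>\<close> many sets of a ranked refinement, then \<open>y \<in> below_rank (c i) x\<close> for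
  one of them, as the ranks are unbounded.
\<close>

lemma ranked_family_cf_many:
  assumes B_ranked: "ranked_family B c" and z_subset_X: "z \<subseteq> X" and card_z: "|Field (cf \<mu>)| \<le>o |z|"
    and x_in_X: "x \<in> X" and x_in_B: "\<And>i. i \<in> z \<Longrightarrow> x \<in> B i" and y_less_x: "y \<in> underS \<kappa> x"
  shows "\<exists>i\<in>z. y \<in> below_rank (c i) x"
proof (rule ccontr)
  assume "\<not> ?thesis"
  then have "(rank x y, c i) \<notin> cf \<mu>" if "i \<in> z" for i
    using that y_less_x unfolding below_rank_def by blast
  moreover have "c i \<in> Field (cf \<mu>)" if "i \<in> z" for i
    using B_ranked that z_subset_X unfolding ranked_family_def by blast
  ultimately have "c ` z \<subseteq> underS (cf \<mu>) (rank x y)"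
    using Well_order_not_le_iff[OF Well_order_cf_\<mu> rank_Field[OF x_in_X]] by blast
  with ranked_family_inj_on[OF B_ranked z_subset_X x_in_B] have "|z| <o cf \<mu>"
    using card_of_underS[OF Card_order_cf_\<mu> rank_Field[OF x_in_X]] by (rule card_of_inj_ordLess)
  then show False
    using ordLeq_ordLess_trans[OF card_z] not_card_of_Field_ordLess[OF Card_order_cf_\<mu>] by blast
qed

lemma regular3_1_cf: "regular3 X I (natLeq_on 1) (cf \<mu>) \<kappa>"
  unfolding regular3_iff
proof (intro allI impI)
  fix A assume "\<forall>i\<in>X. A i \<in> pos"
  then obtain B c where B_refines_A: "pos_refinement X B A" and B_ranked: "ranked_family B c"
    using ranked_refinement by blast
  have "\<exists>C\<subseteq>B i. C \<in> pos \<and> (\<forall>x\<in>C. below_rank (c i) x \<inter> C = {})" if "i \<in> X" for i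
    using B_refines_A B_ranked that unfolding pos_refinement_def ranked_family_def
    by (intro below_rank_free_subset) auto
  then obtain C where C_subset_pos: "\<And>i. i \<in> X \<Longrightarrow> C i \<subseteq> B i \<and> C i \<in> pos"
    and free: "\<And>i x. i \<in> X \<Longrightarrow> x \<in> C i \<Longrightarrow> below_rank (c i) x \<inter> C i = {}" by metis
  have "|X \<inter> (\<Inter>i\<in>z. C i)| \<le>o natLeq_on 1" if z_subset_X: "z \<subseteq> X"
    and z_iso: "Restr \<kappa> z =o cf \<mu>" for z
  proof -
    have card_z: "|Field (cf \<mu>)| \<le>o |z|"
      by (rule ordIso_imp_ordLeq[OF ordIso_symmetric[OF ordIso_Restr_imp_card_of[OF Well_order_\<kappa>
        z_subset_X z_iso]]])
    have less: False if "x \<in> X \<inter> (\<Inter>i\<in>z. C i)" "y \<in> X \<inter> (\<Inter>i\<in>z. C i)" "y \<in> underS \<kappa> x" for x y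
    proof -
      have "x \<in> X" "\<And>i. i \<in> z \<Longrightarrow> x \<in> B i" using that(1) C_subset_pos z_subset_X by blast+
      then obtain i where "i \<in> z" "y \<in> below_rank (c i) x"
        using ranked_family_cf_many[OF B_ranked z_subset_X card_z] \<open>y \<in> underS \<kappa> x\<close> by blast
      then show False using free[of i x] that z_subset_X by blast
    qed
    have "x = y" if "x \<in> X \<inter> (\<Inter>i\<in>z. C i)" "y \<in> X \<inter> (\<Inter>i\<in>z. C i)" for x y
      using less[OF that] less[OF that(2,1)] Well_order_underS_cases[OF Well_order_\<kappa>, of x y] that
      by blast
    then have "inj_on (\<lambda>x. 0::nat) (X \<inter> (\<Inter>i\<in>z. C i))" by (intro inj_onI)
    then have "|X \<inter> (\<Inter>i\<in>z. C i)| \<le>o |{x::nat. x < 1}|" by (rule card_of_ordLeqI) simp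
    then show ?thesis using card_of_least[OF natLeq_on_well_order_on] ordLeq_transitive by blast
  qed
  moreover have "pos_refinement X C A"
    using B_refines_A C_subset_pos unfolding pos_refinement_def by blast
  ultimately show "\<exists>B. pos_refinement X B A \<and>
    (\<forall>x\<subseteq>X. Restr \<kappa> x =o cf \<mu> \<longrightarrow> |X \<inter> (\<Inter>i\<in>x. B i)| \<le>o natLeq_on 1)" by blast
qed

lemma regular2_2_of_point_sparse:
  assumes "\<And>A. \<forall>i\<in>X. A i \<in> pos \<Longrightarrow> \<exists>B. pos_refinement X B A \<and> (\<forall>x\<in>X. |{i\<in>X. x \<in> B i}| <o cf \<mu>)"
  shows "regular2 X I (natLeq_on 2) \<kappa>"
proof (rule regular2_2I[OF Well_order_\<kappa>])
  fix A assume "\<forall>i\<in>X. A i \<in> pos"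
  then obtain B where B_refines_A: "pos_refinement X B A"
    and "\<forall>x\<in>X. |{i\<in>X. x \<in> B i}| <o cf \<mu>" using assms by blast
  then obtain C where "pos_refinement X C B" "disjoint_family_on C X"
    using point_sparse_refinement[of B] unfolding pos_refinement_def by blast
  then show "\<exists>C. pos_refinement X C A \<and> disjoint_family_on C X"
    using pos_refinement_trans B_refines_A by blast
qed

lemma regular2_2_of_regular2_cf:
  assumes "regular2 X I (cf \<mu>) \<kappa>"
  shows "regular2 X I (natLeq_on 2) \<kappa>"
proof (rule regular2_2_of_point_sparse)
  fix A assume "\<forall>i\<in>X. A i \<in> pos"
  then obtain B where B_refines_A: "pos_refinement X B A"
    and disj: "\<And>z. z \<subseteq> X \<Longrightarrow> Restr \<kappa> z =o cf \<mu> \<Longrightarrow> X \<inter> (\<Inter>i\<in>z. B i) = {}"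
    using assms unfolding regular2_iff by meson
  have "|{i\<in>X. x \<in> B i}| <o cf \<mu>" if x_in_X: "x \<in> X" for x
  proof (rule ccontr)
    let ?Z = "{i\<in>X. x \<in> B i}"
    assume "\<not> |?Z| <o cf \<mu>"
    then have "cf \<mu> \<le>o |?Z|" using not_card_of_ordLess_iff[OF Card_order_cf_\<mu>] by blast
    then obtain z where z_subset_Z: "z \<subseteq> ?Z" and z_iso: "Restr \<kappa> z =o cf \<mu>"
      using subset_of_ordertype[OF Well_order_\<kappa>, of ?Z] by blast
    then have "X \<inter> (\<Inter>i\<in>z. B i) = {}" by (intro disj) blast+
    then show False using z_subset_Z x_in_X by blast
  qed
  then show "\<exists>B. pos_refinement X B A \<and> (\<forall>x\<in>X. |{i\<in>X. x \<in> B i}| <o cf \<mu>)" using B_refines_A by blast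
qed

lemma card_of_subsets_of_ordertype:
  assumes Well_order_\<beta>: "Well_order \<beta>" and exp_le: "\<mu> ^c \<beta> \<le>o \<mu>" and i_in_X: "i \<in> X"
  shows "|{y. y \<subseteq> underS \<kappa> i \<and> Restr \<kappa> y =o \<beta>}| \<le>o \<mu>"
proof (rule card_of_subset_ordLeq)
  show "{y. y \<subseteq> underS \<kappa> i \<and> Restr \<kappa> y =o \<beta>} \<subseteq> {y. y \<subseteq> underS \<kappa> i \<and> |y| =o |Field \<beta>| }"
    using ordIso_Restr_imp_card_of[OF Well_order_\<kappa>] Order_Relation.underS_Field[of \<kappa> i] by blast
  have "|underS \<kappa> i| ^c \<beta> \<le>o \<mu> ^c \<beta>"
    by (rule cexp_mono'[OF card_of_underS_\<kappa>[OF i_in_X] ordLeq_reflexive[OF Well_order_\<beta>]])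
  then show "|{y. y \<subseteq> underS \<kappa> i \<and> |y| =o |Field \<beta>| }| \<le>o \<mu>"
    by (rule ordLeq_transitive[OF card_of_subsets_ordLeq_cexp ordLeq_transitive[OF _ exp_le]])
qed

lemma regular2_2_of_regular3:
  assumes \<alpha>_less_\<kappa>: "\<alpha> <o \<kappa>" and Well_order_\<beta>: "Well_order \<beta>" and exp_le: "\<mu> ^c \<beta> \<le>o \<mu>"
    and regular: "regular3 X I \<alpha> \<beta> \<kappa>"
  shows "regular2 X I (natLeq_on 2) \<kappa>"
proof (rule regular2_2_of_point_sparse)
  fix A assume "\<forall>i\<in>X. A i \<in> pos"
  then obtain B where B_refines_A: "pos_refinement X B A"
    and small: "\<And>z. z \<subseteq> X \<Longrightarrow> Restr \<kappa> z =o \<beta> \<Longrightarrow> |X \<inter> (\<Inter>i\<in>z. B i)| \<le>o \<alpha>"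
    using regular unfolding regular3_iff by meson
  define N where "N i = (\<Union>y\<in>{y. y \<subseteq> underS \<kappa> i \<and> Restr \<kappa> y =o \<beta>}. X \<inter> (\<Inter>j\<in>y. B j))" for i
  have "N i \<in> I" if i_in_X: "i \<in> X" for i
    unfolding N_def
  proof (rule null_UN[OF card_of_subsets_of_ordertype[OF Well_order_\<beta> exp_le i_in_X]])
    fix y assume "y \<in> {y. y \<subseteq> underS \<kappa> i \<and> Restr \<kappa> y =o \<beta>}"
    then have "|X \<inter> (\<Inter>j\<in>y. B j)| \<le>o \<alpha>"
      using Order_Relation.underS_Field[of \<kappa> i] by (intro small) auto
    then show "X \<inter> (\<Inter>j\<in>y. B j) \<in> I"
      using \<alpha>_less_\<kappa> ordLeq_ordLess_trans ordLess_\<kappa>_iff by (intro null_small) blast+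
  qed
  then have Diff_refines_A: "pos_refinement X (\<lambda>i. B i - N i) A"
    using B_refines_A pos_Diff_null unfolding pos_refinement_def by blast
  have "|{i\<in>X. x \<in> B i - N i}| <o cf \<mu>" if x_in_X: "x \<in> X" for x
  proof (rule ccontr)
    let ?Z = "{i\<in>X. x \<in> B i - N i}"
    assume "\<not> |?Z| <o cf \<mu>"
    then have "\<beta> <o |?Z|"
      using cexp_ordLeq_imp_ordLess_cf[OF Cinfinite_\<mu> Well_order_\<beta> exp_le]
        not_card_of_ordLess_iff[OF Card_order_cf_\<mu>] ordLess_ordLeq_trans by blast
    then obtain a z where a_in_Z: "a \<in> ?Z" and z_subset: "z \<subseteq> ?Z \<inter> underS \<kappa> a"
      and z_iso: "Restr \<kappa> z =o \<beta>"
      using bounded_subset_of_ordertype[OF Well_order_\<kappa>, of ?Z \<beta>] by blast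
    have "x \<in> X \<inter> (\<Inter>j\<in>z. B j)" using x_in_X z_subset by blast
    then have "x \<in> N a" using z_subset z_iso unfolding N_def by blast
    then show False using a_in_Z by blast
  qed
  with Diff_refines_A show "\<exists>B. pos_refinement X B A \<and> (\<forall>x\<in>X. |{i\<in>X. x \<in> B i}| <o cf \<mu>)"
    by (intro exI[of _ "\<lambda>i. B i - N i"]) blast
qed

end

theorem theorem2:
  fixes \<mu> :: "'a rel" and \<kappa> :: "'a set rel" and I :: "'a set set set"
  assumes "Cinfinite \<mu>"
    and "\<kappa> = cardSuc \<mu>"
    and "ideal_on (Field \<kappa>) I"
    and "proper_ideal (Field \<kappa>) I"
    and "nonprincipal_ideal (Field \<kappa>) I"
    and "complete_ideal \<kappa> I"
  shows "(regular2 (Field \<kappa>) I (ordsuc (cf \<mu>)) \<kappa>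
          \<and> regular3 (Field \<kappa>) I (natLeq_on 1) (cf \<mu>) \<kappa>
          \<and> (\<forall>\<delta> :: 'a set rel. Well_order \<delta> \<and> \<delta> <o \<kappa> \<longrightarrow> regular2 (Field \<kappa>) I (natLeq_on 2) \<delta>))
     \<and> (regular2 (Field \<kappa>) I (cf \<mu>) \<kappa> \<longrightarrow> regular2 (Field \<kappa>) I (natLeq_on 2) \<kappa>)
     \<and> ((\<exists>(\<alpha> :: 'a set rel) (\<beta> :: 'a set rel). Well_order \<alpha> \<and> \<alpha> <o \<kappa> \<and> Well_order \<beta> \<and> \<beta> <o \<kappa>
            \<and> \<mu> ^c \<beta> =o \<mu> \<and> regular3 (Field \<kappa>) I \<alpha> \<beta> \<kappa>)
          \<longrightarrow> regular2 (Field \<kappa>) I (natLeq_on 2) \<kappa>)"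
proof -
  have "\<kappa> =o cardSuc \<mu>" using assms(1,2) by (simp add: ordIso_refl cardSuc_Card_order)
  then interpret ideal_on_succ_cardinal \<mu> \<kappa> I using assms by unfold_locales
  have "regular2 (Field \<kappa>) I (natLeq_on 2) \<kappa>"
    if "\<alpha> <o \<kappa>" "Well_order \<beta>" "\<mu> ^c \<beta> =o \<mu>" "regular3 (Field \<kappa>) I \<alpha> \<beta> \<kappa>" for \<alpha> \<beta> :: "'a set rel"
    by (rule regular2_2_of_regular3[OF that(1,2) ordIso_imp_ordLeq[OF that(3)] that(4)])
  then show ?thesis
    using regular2_ordsuc_cf regular3_1_cf regular2_2_less_\<kappa> regular2_2_of_regular2_cf by blast
qed

end
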